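(* Let $S=\{R_0,\dots,R_d\}$ be an association scheme of class $d$ on a nonempty finite set $X$, let $x\in X$, let $\mathbb{F}$ be a field of positive characteristic $p$, let $T=T(x)$ be the modular Terwilliger algebra of $S$ over $\mathbb{F}$ with respect to $x$, and let $W_0$ be the primary module of $T$. Let $\epsilon=\max\{m\in\mathbb{N}_0:\exists\, i\in[0,d],\ p^m\mid k_i\}$ and let $Q=\{n\in[0,\epsilon]: Q_n\neq\varnothing\}$. Then: (i) $\bigcup_{q\in Q}\bigcup_{C\in Q_q}\{Irr_q(C)\}$ is the set of all composition factors of $W_0$ with respect to a composition series of $W_0$. Furthermore, $\bigcup_{q\in Q}\bigcup_{C\in Q_q}\{Irr_q(C)\}$ is a complete set of representatives of the isomorphism classes of all composition factors of $W_0$. (ii) $\sum_{q\in Q}|Q_q|$ equals the composition length of $W_0$. Furthermore, $\sum_{q\in Q}|Q_q|$ equals the number of isomorphism classes of all composition factors of $W_0$.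
   Context: Conventions: $\mathbb{N}=\{1,2,\dots\}$, $\mathbb{N}_0=\mathbb{N}\cup\{0\}$, $[a,b]=\{c\in\mathbb{N}_0: a\le c\le b\}$; $\langle Y\rangle_{\mathbb{F}}$ is the $\mathbb{F}$-span of $Y$ (and $\langle\varnothing\rangle_{\mathbb F}=0$). All modules are finitely generated left modules. Scheme: an association scheme of class $d$ on $X$ is a partition $S=\{R_0,\dots,R_d\}$ of $X\times X$ (into $d+1$ nonempty parts) such that $R_0=\{(y,y):y\in X\}$; for each $i\in[0,d]$ there is $i'\in[0,d]$ with $R_{i'}=\{(y,z):(z,y)\in R_i\}$; and for all $i,j,\ell\in[0,d]$ the number $p_{ij}^{\ell}=|\{w\in X:(y,w)\in R_i,\ (w,z)\in R_j\}|$ does not depend on the choice of $(y,z)\in R_\ell$. The valency of $R_i$ is $k_i=p_{ii'}^0>0$. Terwilliger algebra: in the algebra $M_X(\mathbb{F})$ of matrices with rows and columns indexed by $X$, $A_i$ is the $\{0,1\}$-matrix whose $(y,z)$-entry is $1$ iff $(y,z)\in R_i$, and $E_i^*$ is the diagonal $\{0,1\}$-matrix whose $(y,y)$-entry is $1$ iff $(x,y)\in R_i$. $T$ is the unital $\mathbb{F}$-subalgebra of $M_X(\mathbb{F})$ generated by $A_0,\dots,A_d,E_0^*,\dots,E_d^*$. It acts by left multiplication on the space $\mathbb{F}^X$ of column vectors; $\mathbf{1}\in\mathbb{F}^X$ is the all-one vector, $\mathbf 0$ the zero vector. The modules $W_n$: $W_0=\langle\{E_i^*\mathbf{1}:i\in[0,d]\}\rangle_{\mathbb{F}}$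 is a $T$-module, called the primary module of $T$; for $n\in\mathbb{N}$, $W_n=\langle\{E_i^*\mathbf{1}:i\in[0,d],\ p^n\mid k_i\}\rangle_{\mathbb{F}}$ is a $T$-submodule of $W_0$, and $W_{n+1}\subseteq W_n$. The sets $S_n$, $Q_n$: for $n\in\mathbb{N}_0$, $S_n=\{j\in[0,d]:p^n\mid k_j,\ p^{n+1}\nmid k_j\}$. Define $i\sim j$ on $[0,d]$ iff both: (a) there are $m\in\mathbb{N}_0$ and a sequence $i_0,j_0,\ell_0,\dots,i_m,j_m,\ell_m$ in $[0,d]$ with $i_0=i$, $\ell_m=j$, $p\nmid\prod_{a=0}^m p_{\ell_a j_a'}^{i_a}$, and $\ell_{b-1}=i_b$ for every $b\in[1,m]$; (b) there are $n\in\mathbb{N}_0$ and a sequence $r_0,s_0,t_0,\dots,r_n,s_n,t_n$ in $[0,d]$ with $r_0=j$, $t_n=i$, $p\nmid\prod_{c=0}^n p_{t_c s_c'}^{r_c}$, and $t_{e-1}=r_e$ for every $e\in[1,n]$. The relation $\sim$ is an equivalence relation on $[0,d]$. Let $\sim_n$ be its restriction to $S_n$, and let $Q_n$ be the set of equivalence classes of $S_n$ under $\sim_n$ (with $Q_n=\varnothing$ if $S_n=\varnothing$). $Irr_n(C)$: for $C\in Q_n$, $Irr_n(C)=\langle\{E_i^*\mathbf{1}+W_{n+1}:i\in C\}\rangle_{\mathbb{F}}\subseteq W_n/W_{n+1}$, which is an irreducible $T$-submodule of $W_n/W_{n+1}$. *)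

theory Defs
  imports
    "HOL-Analysis.Cartesian_Space"
    "HOL-Algebra.Module"
    "HOL-Algebra.AbelCoset"
    "HOL-Library.Disjoint_Sets"
begin

text \<open>The library locale \<^locale>\<open>module\<close> requires a commutative ring of scalars, so it cannot be
  used for modules over a Terwilliger algebra. The record type \<^typ>\<open>('a, 'b) module\<close> and the
  predicate \<^const>\<open>submodule\<close> make no such assumption and are reused.\<close>

locale left_module = R?: ring R + M?: abelian_group M for R and M (structure) +
  assumes smult_closed:
      "\<lbrakk>a \<in> carrier R; v \<in> carrier M\<rbrakk> \<Longrightarrow> a \<odot>\<^bsub>M\<^esub> v \<in> carrier M"
    and smult_l_distr:
      "\<lbrakk>a \<in> carrier R; b \<in> carrier R; v \<in> carrier M\<rbrakk> \<Longrightarrow>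
        (a \<oplus>\<^bsub>R\<^esub> b) \<odot>\<^bsub>M\<^esub> v = a \<odot>\<^bsub>M\<^esub> v \<oplus>\<^bsub>M\<^esub> b \<odot>\<^bsub>M\<^esub> v"
    and smult_r_distr:
      "\<lbrakk>a \<in> carrier R; v \<in> carrier M; w \<in> carrier M\<rbrakk> \<Longrightarrow>
        a \<odot>\<^bsub>M\<^esub> (v \<oplus>\<^bsub>M\<^esub> w) = a \<odot>\<^bsub>M\<^esub> v \<oplus>\<^bsub>M\<^esub> a \<odot>\<^bsub>M\<^esub> w"
    and smult_assoc:
      "\<lbrakk>a \<in> carrier R; b \<in> carrier R; v \<in> carrier M\<rbrakk> \<Longrightarrow>
        (a \<otimes>\<^bsub>R\<^esub> b) \<odot>\<^bsub>M\<^esub> v = a \<odot>\<^bsub>M\<^esub> (b \<odot>\<^bsub>M\<^esub> v)"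
    and smult_one:
      "v \<in> carrier M \<Longrightarrow> \<one>\<^bsub>R\<^esub> \<odot>\<^bsub>M\<^esub> v = v"

definition module_isomorphic ::
    "('a, 'r) ring_scheme \<Rightarrow> ('a, 'b) module \<Rightarrow> ('a, 'c) module \<Rightarrow> bool" where
  "module_isomorphic R M N \<longleftrightarrow>
     (\<exists>f \<in> iso (add_monoid M) (add_monoid N).
        \<forall>a \<in> carrier R. \<forall>v \<in> carrier M. f (a \<odot>\<^bsub>M\<^esub> v) = a \<odot>\<^bsub>N\<^esub> f v)"

definition irreducible_module :: "('a, 'r) ring_scheme \<Rightarrow> ('a, 'b) module \<Rightarrow> bool" where
  "irreducible_module R M \<longleftrightarrow>
     left_module R M \<and> carrier M \<noteq> {\<zero>\<^bsub>M\<^esub>} \<and>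
     (\<forall>H. submodule H R M \<longrightarrow> H = {\<zero>\<^bsub>M\<^esub>} \<or> H = carrier M)"

text \<open>The quotient \<open>M / N\<close>, with cosets as elements. The record type inherits the fields
  \<^const>\<open>monoid.mult\<close> and \<^const>\<open>monoid.one\<close>, which have no meaning for modules.\<close>

definition quotient_module :: "('a, 'b) module \<Rightarrow> 'b set \<Rightarrow> ('a, 'b set) module" where
  "quotient_module M N =
     \<lparr>carrier = a_rcosets\<^bsub>M\<^esub> N, mult = undefined, one = undefined,
      zero = N, add = set_add M,
      smult = (\<lambda>a K. \<Union>v\<in>K. N +>\<^bsub>M\<^esub> (a \<odot>\<^bsub>M\<^esub> v))\<rparr>"

definition series_factor :: "('a, 'b) module \<Rightarrow> (nat \<Rightarrow> 'b set) \<Rightarrow> nat \<Rightarrow> ('a, 'b set) module" where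
  "series_factor M H k = quotient_module (M\<lparr>carrier := H (Suc k)\<rparr>) (H k)"

text \<open>\<open>0 = H 0 \<subset> H 1 \<subset> \<dots> \<subset> H l = M\<close>; the values of \<open>H\<close> beyond \<open>l\<close> are irrelevant.\<close>

definition composition_series ::
    "('a, 'r) ring_scheme \<Rightarrow> ('a, 'b) module \<Rightarrow> (nat \<Rightarrow> 'b set) \<Rightarrow> nat \<Rightarrow> bool" where
  "composition_series R M H l \<longleftrightarrow>
     H 0 = {\<zero>\<^bsub>M\<^esub>} \<and> H l = carrier M \<and>
     (\<forall>k\<le>l. submodule (H k) R M) \<and>
     (\<forall>k<l. H k \<subset> H (Suc k) \<and> irreducible_module R (series_factor M H k))"

definition composition_factors ::
    "('a, 'r) ring_scheme \<Rightarrow> ('a, 'b) module \<Rightarrow> ('a, 'b set) module set" where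
  "composition_factors R M = {series_factor M H k | H l k. composition_series R M H l \<and> k < l}"

definition composition_length :: "('a, 'r) ring_scheme \<Rightarrow> ('a, 'b) module \<Rightarrow> nat" where
  "composition_length R M = (THE l. \<exists>H. composition_series R M H l)"

definition isomorphism_classes ::
    "('a, 'r) ring_scheme \<Rightarrow> ('a, 'b) module set \<Rightarrow> ('a, 'b) module set set" where
  "isomorphism_classes R \<M> =
     \<M> // {(M, N). M \<in> \<M> \<and> N \<in> \<M> \<and> module_isomorphic R M N}"

text \<open>Equality of two sets of modules when isomorphic modules are identified.\<close>

definition equal_up_to_iso ::
    "('a, 'r) ring_scheme \<Rightarrow> ('a, 'b) module set \<Rightarrow> ('a, 'c) module set \<Rightarrow> bool" where
  "equal_up_to_iso R \<M> \<N> \<longleftrightarrow>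
     (\<forall>M\<in>\<M>. \<exists>N\<in>\<N>. module_isomorphic R M N) \<and>
     (\<forall>N\<in>\<N>. \<exists>M\<in>\<M>. module_isomorphic R M N)"

definition complete_representatives ::
    "('a, 'r) ring_scheme \<Rightarrow> ('a, 'b) module set \<Rightarrow> ('a, 'c) module set \<Rightarrow> bool" where
  "complete_representatives R \<M> \<N> \<longleftrightarrow>
     (\<forall>N\<in>\<N>. \<exists>M\<in>\<M>. module_isomorphic R M N) \<and>
     (\<forall>M\<in>\<M>. \<exists>!N. N \<in> \<N> \<and> module_isomorphic R M N)"

text \<open>The underlying set is the finite (and nonempty) type \<open>'x\<close>; only \<open>R 0, \<dots>, R d\<close> matter.\<close>

definition association_scheme :: "nat \<Rightarrow> (nat \<Rightarrow> ('x::finite \<times> 'x) set) \<Rightarrow> bool" where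
  "association_scheme d R \<longleftrightarrow>
     partition_on UNIV (R ` {..d}) \<and> inj_on R {..d} \<and>
     R 0 = Id \<and>
     (\<forall>i\<le>d. \<exists>i'\<le>d. R i' = {(y, z). (z, y) \<in> R i}) \<and>
     (\<forall>i\<le>d. \<forall>j\<le>d. \<forall>l\<le>d. \<exists>n. \<forall>(y, z)\<in>R l.
        card {w. (y, w) \<in> R i \<and> (w, z) \<in> R j} = n)"

definition converse_index :: "nat \<Rightarrow> (nat \<Rightarrow> ('x::finite \<times> 'x) set) \<Rightarrow> nat \<Rightarrow> nat" where
  "converse_index d R i = (THE i'. i' \<le> d \<and> R i' = {(y, z). (z, y) \<in> R i})"

text \<open>\<open>intersection_number R i j l\<close> is \<open>p\<^sub>i\<^sub>j\<close> with upper index \<open>l\<close>.\<close>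

definition intersection_number ::
    "(nat \<Rightarrow> ('x::finite \<times> 'x) set) \<Rightarrow> nat \<Rightarrow> nat \<Rightarrow> nat \<Rightarrow> nat" where
  "intersection_number R i j l =
     (THE n. \<forall>(y, z)\<in>R l. card {w. (y, w) \<in> R i \<and> (w, z) \<in> R j} = n)"

definition valency :: "nat \<Rightarrow> (nat \<Rightarrow> ('x::finite \<times> 'x) set) \<Rightarrow> nat \<Rightarrow> nat" where
  "valency d R i = intersection_number R i (converse_index d R i) 0"

definition adjacency_matrix ::
    "(nat \<Rightarrow> ('x::finite \<times> 'x) set) \<Rightarrow> nat \<Rightarrow> 'f::field ^ 'x ^ 'x" where
  "adjacency_matrix R i = (\<chi> y z. if (y, z) \<in> R i then 1 else 0)"

definition dual_idempotent ::
    "(nat \<Rightarrow> ('x::finite \<times> 'x) set) \<Rightarrow> 'x \<Rightarrow> nat \<Rightarrow> 'f::field ^ 'x ^ 'x" where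
  "dual_idempotent R x i = (\<chi> y z. if y = z \<and> (x, y) \<in> R i then 1 else 0)"

definition unital_subalgebra :: "('f::field ^ 'x::finite ^ 'x) set \<Rightarrow> bool" where
  "unital_subalgebra \<A> \<longleftrightarrow>
     mat 1 \<in> \<A> \<and>
     (\<forall>A\<in>\<A>. \<forall>B\<in>\<A>. A + B \<in> \<A> \<and> A ** B \<in> \<A>) \<and>
     (\<forall>c. \<forall>A\<in>\<A>. map_matrix (\<lambda>a. c * a) A \<in> \<A>)"

definition matrix_ring :: "('f::field ^ 'x::finite ^ 'x) set \<Rightarrow> ('f ^ 'x ^ 'x) ring" where
  "matrix_ring \<A> = \<lparr>carrier = \<A>, mult = (**), one = mat 1, zero = 0, add = (+)\<rparr>"

definition terwilliger_algebra ::
    "nat \<Rightarrow> (nat \<Rightarrow> ('x::finite \<times> 'x) set) \<Rightarrow> 'x \<Rightarrow> ('f::field ^ 'x ^ 'x) ring" where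
  "terwilliger_algebra d R x =
     matrix_ring (unital_subalgebra hull
       (adjacency_matrix R ` {..d} \<union> dual_idempotent R x ` {..d}))"

definition column_module ::
    "('f::field ^ 'x::finite) set \<Rightarrow> ('f ^ 'x ^ 'x, 'f ^ 'x) module" where
  "column_module U =
     \<lparr>carrier = U, mult = undefined, one = undefined, zero = 0, add = (+), smult = (*v)\<rparr>"

text \<open>The vector \<open>E\<^sub>i\<^sup>* \<one>\<close>.\<close>

definition dual_vector ::
    "(nat \<Rightarrow> ('x::finite \<times> 'x) set) \<Rightarrow> 'x \<Rightarrow> nat \<Rightarrow> 'f::field ^ 'x" where
  "dual_vector R x i = dual_idempotent R x i *v (\<chi> y. 1)"

text \<open>For \<open>n = 0\<close> the divisibility condition is void, so this also covers \<open>W\<^sub>0\<close>.\<close>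

definition W_space ::
    "nat \<Rightarrow> nat \<Rightarrow> (nat \<Rightarrow> ('x::finite \<times> 'x) set) \<Rightarrow> 'x \<Rightarrow> nat \<Rightarrow> ('f::field ^ 'x) set" where
  "W_space p d R x n = vec.span (dual_vector R x ` {i. i \<le> d \<and> p ^ n dvd valency d R i})"

definition primary_module ::
    "nat \<Rightarrow> (nat \<Rightarrow> ('x::finite \<times> 'x) set) \<Rightarrow> 'x \<Rightarrow> ('f::field ^ 'x ^ 'x, 'f ^ 'x) module" where
  "primary_module d R x = column_module (vec.span (dual_vector R x ` {..d}))"

text \<open>The span over the ground field in a module over a unital matrix algebra; the field acts
  through the scalar matrices \<^term>\<open>mat c\<close>.\<close>

definition field_span ::
    "('f::field ^ 'x::finite ^ 'x, 'b) module \<Rightarrow> 'b set \<Rightarrow> 'b set" where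
  "field_span M Y = (\<lambda>H. submodule H (matrix_ring (range mat)) M) hull Y"

definition S_set :: "nat \<Rightarrow> nat \<Rightarrow> (nat \<Rightarrow> ('x::finite \<times> 'x) set) \<Rightarrow> nat \<Rightarrow> nat set" where
  "S_set p d R n = {j. j \<le> d \<and> p ^ n dvd valency d R j \<and> \<not> p ^ (n + 1) dvd valency d R j}"

definition chain_related ::
    "nat \<Rightarrow> nat \<Rightarrow> (nat \<Rightarrow> ('x::finite \<times> 'x) set) \<Rightarrow> nat \<Rightarrow> nat \<Rightarrow> bool" where
  "chain_related p d R i j \<longleftrightarrow>
     (\<exists>(m::nat) is js ls.
        (\<forall>a\<le>m. is a \<le> d \<and> js a \<le> d \<and> ls a \<le> d) \<and>
        is 0 = i \<and> ls m = j \<and>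
        \<not> p dvd (\<Prod>a=0..m. intersection_number R (ls a) (converse_index d R (js a)) (is a)) \<and>
        (\<forall>b\<in>{1..m}. ls (b - 1) = is b))"

definition sim :: "nat \<Rightarrow> nat \<Rightarrow> (nat \<Rightarrow> ('x::finite \<times> 'x) set) \<Rightarrow> nat \<Rightarrow> nat \<Rightarrow> bool" where
  "sim p d R i j \<longleftrightarrow> chain_related p d R i j \<and> chain_related p d R j i"

definition Q_classes ::
    "nat \<Rightarrow> nat \<Rightarrow> (nat \<Rightarrow> ('x::finite \<times> 'x) set) \<Rightarrow> nat \<Rightarrow> nat set set" where
  "Q_classes p d R n =
     S_set p d R n // {(i, j). i \<in> S_set p d R n \<and> j \<in> S_set p d R n \<and> sim p d R i j}"

definition epsilon :: "nat \<Rightarrow> nat \<Rightarrow> (nat \<Rightarrow> ('x::finite \<times> 'x) set) \<Rightarrow> nat" where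
  "epsilon p d R = Max {m. \<exists>i\<le>d. p ^ m dvd valency d R i}"

definition Q_index :: "nat \<Rightarrow> nat \<Rightarrow> (nat \<Rightarrow> ('x::finite \<times> 'x) set) \<Rightarrow> nat set" where
  "Q_index p d R = {n \<in> {0..epsilon p d R}. Q_classes p d R n \<noteq> {}}"

definition Irr ::
    "nat \<Rightarrow> nat \<Rightarrow> (nat \<Rightarrow> ('x::finite \<times> 'x) set) \<Rightarrow> 'x \<Rightarrow> nat \<Rightarrow> nat set
      \<Rightarrow> ('f::field ^ 'x ^ 'x, ('f ^ 'x) set) module" where
  "Irr p d R x n C =
     (let M = column_module (W_space p d R x n); N = W_space p d R x (n + 1); V = quotient_module M N
      in V\<lparr>carrier := field_span V ((\<lambda>i. N +>\<^bsub>M\<^esub> dual_vector R x i) ` C)\<rparr>)"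

definition Irr_modules ::
    "nat \<Rightarrow> nat \<Rightarrow> (nat \<Rightarrow> ('x::finite \<times> 'x) set) \<Rightarrow> 'x
      \<Rightarrow> ('f::field ^ 'x ^ 'x, ('f ^ 'x) set) module set" where
  "Irr_modules p d R x = (\<Union>q\<in>Q_index p d R. \<Union>C\<in>Q_classes p d R q. {Irr p d R x q C})"

end

theory Submission
  imports Defs "HOL-Computational_Algebra.Primes"
begin

text \<open>The vectors \<open>E\<^sub>i\<^sup>* \<one>\<close> are the indicator functions of the cells \<open>x R\<^sub>i\<close>, so they are linearly
independent, and \<open>E\<^sub>l\<^sup>* A\<^sub>j\<close> sends \<open>E\<^sub>i\<^sup>* \<one>\<close> to the multiple of \<open>E\<^sub>l\<^sup>* \<one>\<close> by the intersection
number with lower indices \<open>i, j'\<close> and upper index \<open>l\<close>. Draw an arc from \<open>i\<close> to \<open>l\<close> when one of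
these numbers is nonzero modulo \<open>p\<close>. Since \<open>T\<close> contains the projections \<open>E\<^sub>i\<^sup>*\<close>, a submodule of
\<open>W\<^sub>0\<close> is spanned by the \<open>E\<^sub>i\<^sup>* \<one>\<close> which it contains, and the index sets that arise are exactly
those closed under following arcs. The submodule structure of \<open>W\<^sub>0\<close> is thereby the combinatorics
of a finite digraph: a composition series is a maximal chain of closed sets, each step of such a
chain adds one strongly connected component, and each component is added exactly once
(\<open>closed_chain_bij\<close>, \<open>composition_series_iff\<close>).

The factor belonging to a step from \<open>J\<close> to \<open>I\<close> depends only on \<open>I - J\<close>. It is isomorphic to
the \<^emph>\<open>layer\<close> of \<open>I - J\<close>: the functions supported on the cells of \<open>I - J\<close>, with the action of \<open>T\<close>
truncated to these cells (\<open>quotient_isomorphic_layer\<close>). Layers of different components are not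
isomorphic, because \<open>E\<^sub>i\<^sup>*\<close> acts as zero on one of them and not on the other.

It remains to see that the classes in the sets \<open>Q\<^sub>n\<close> are the components and that \<open>Irr\<^sub>n(C)\<close> is
isomorphic to the layer of \<open>C\<close>. Both follow by counting triangles in two ways, which gives
\<open>k\<^sub>l c = k\<^sub>i c'\<close>, where \<open>c\<close> is the intersection number with lower indices \<open>i, j'\<close> and upper index
\<open>l\<close>, and \<open>c'\<close> the one with lower indices \<open>l, j\<close> and upper index \<open>i\<close>
(\<open>valency_mult_intersection_number\<close>). Along an arc the \<open>p\<close>-part of the
valency therefore cannot decrease, and an arc between indices whose valencies have the same
\<open>p\<close>-part can be reversed. So a component stays inside a single \<open>S\<^sub>n\<close>, and the union of a class
\<open>C \<subseteq> S\<^sub>n\<close> with the index set of \<open>W\<^bsub>n+1\<^esub>\<close> is closed.\<close>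

section \<open>Isomorphisms and submodules of left modules\<close>

lemma isoE_bij:
  assumes "f \<in> iso (add_monoid M) (add_monoid N)"
  shows "bij_betw f (carrier M) (carrier N)"
    and "\<And>v w. v \<in> carrier M \<Longrightarrow> w \<in> carrier M \<Longrightarrow> f (v \<oplus>\<^bsub>M\<^esub> w) = f v \<oplus>\<^bsub>N\<^esub> f w"
  using assms by (auto simp: iso_def hom_def)

lemma module_isomorphic_sym:
  assumes "left_module R M" and "module_isomorphic R M N"
  shows "module_isomorphic R N M"
proof -
  interpret left_module R M by fact
  obtain f where f: "f \<in> iso (add_monoid M) (add_monoid N)"
    and smult: "\<And>a v. a \<in> carrier R \<Longrightarrow> v \<in> carrier M \<Longrightarrow> f (a \<odot>\<^bsub>M\<^esub> v) = a \<odot>\<^bsub>N\<^esub> f v"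
    using assms(2) unfolding module_isomorphic_def by blast
  let ?g = "inv_into (carrier M) f"
  note bij = isoE_bij(1)[OF f]
  have "group (add_monoid M)"
    using M.a_comm_group by (simp add: comm_group_def)
  then have "?g \<in> iso (add_monoid N) (add_monoid M)"
    using group.iso_set_sym[OF _ f] by simp
  moreover have "?g (a \<odot>\<^bsub>N\<^esub> w) = a \<odot>\<^bsub>M\<^esub> ?g w" if a: "a \<in> carrier R" and w: "w \<in> carrier N" for a w
  proof -
    have gw: "?g w \<in> carrier M" "f (?g w) = w"
      using bij w by (auto simp: bij_betw_def inv_into_into f_inv_into_f)
    then have "a \<odot>\<^bsub>N\<^esub> w = f (a \<odot>\<^bsub>M\<^esub> ?g w)"
      using smult[OF a gw(1)] by simp
    then show ?thesis
      using bij gw(1) a by (simp add: bij_betw_def inv_into_f_f smult_closed)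
  qed
  ultimately show ?thesis
    unfolding module_isomorphic_def by blast
qed

lemma module_isomorphic_trans:
  assumes "module_isomorphic R M N" and "module_isomorphic R N L"
  shows "module_isomorphic R M L"
proof -
  obtain f where f: "f \<in> iso (add_monoid M) (add_monoid N)"
    and fs: "\<And>a v. a \<in> carrier R \<Longrightarrow> v \<in> carrier M \<Longrightarrow> f (a \<odot>\<^bsub>M\<^esub> v) = a \<odot>\<^bsub>N\<^esub> f v"
    using assms(1) unfolding module_isomorphic_def by blast
  obtain g where g: "g \<in> iso (add_monoid N) (add_monoid L)"
    and gs: "\<And>a v. a \<in> carrier R \<Longrightarrow> v \<in> carrier N \<Longrightarrow> g (a \<odot>\<^bsub>N\<^esub> v) = a \<odot>\<^bsub>L\<^esub> g v"
    using assms(2) unfolding module_isomorphic_def by blast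
  have "f v \<in> carrier N" if "v \<in> carrier M" for v
    using isoE_bij(1)[OF f] that by (auto simp: bij_betw_def)
  then have "\<forall>a\<in>carrier R. \<forall>v\<in>carrier M. (g \<circ> f) (a \<odot>\<^bsub>M\<^esub> v) = a \<odot>\<^bsub>L\<^esub> (g \<circ> f) v"
    by (simp add: fs gs)
  then show ?thesis
    using iso_set_trans[OF f g] unfolding module_isomorphic_def by blast
qed

lemma iso_zero:
  assumes "left_module R M" and "left_module R N" and "f \<in> iso (add_monoid M) (add_monoid N)"
  shows "f \<zero>\<^bsub>M\<^esub> = \<zero>\<^bsub>N\<^esub>"
proof -
  have "group (add_monoid M)" "group (add_monoid N)"
    using assms(1,2) by (auto simp: left_module_def abelian_group_def abelian_group_axioms_def comm_group_def)
  from hom_one[OF iso_imp_homomorphism[OF assms(3)] this] show ?thesis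
    by simp
qed

text \<open>For quotient modules this saves checking the module axioms on cosets.\<close>

lemma left_module_transfer:
  assumes "left_module R M" and f: "f \<in> iso (add_monoid M) (add_monoid N)"
    and zero: "f \<zero>\<^bsub>M\<^esub> = \<zero>\<^bsub>N\<^esub>"
    and smult: "\<And>a v. a \<in> carrier R \<Longrightarrow> v \<in> carrier M \<Longrightarrow> f (a \<odot>\<^bsub>M\<^esub> v) = a \<odot>\<^bsub>N\<^esub> f v"
  shows "left_module R N"
proof -
  interpret left_module R M by fact
  note bij = isoE_bij(1)[OF f] and add = isoE_bij(2)[OF f]
  have into: "f v \<in> carrier N" if "v \<in> carrier M" for v
    using bij that by (auto simp: bij_betw_def)
  have onto: "\<exists>v\<in>carrier M. w = f v" if "w \<in> carrier N" for w
    using bij that by (auto simp: bij_betw_def)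
  have "group (add_monoid M)"
    using M.a_comm_group by (simp add: comm_group_def)
  then have "group (add_monoid N)"
    using group.iso_imp_img_group[OF _ f] zero by simp
  then have "comm_group (add_monoid N)"
    using onto add into by (auto intro!: group.group_comm_groupI dest!: onto simp: M.a_comm simp flip: add)
  then have grp: "abelian_group N"
    by (simp add: abelian_group_def abelian_group_axioms_def abelian_monoid_def comm_group_def)
  show ?thesis
  proof (intro left_module.intro left_module_axioms.intro grp)
    show "ring R" by unfold_locales
  qed (use into in \<open>auto dest!: onto simp: smult_closed smult_l_distr smult_r_distr smult_assoc smult_one
        simp flip: smult add\<close>)
qed

context left_module
begin

lemma zero_smult: "v \<in> carrier M \<Longrightarrow> \<zero>\<^bsub>R\<^esub> \<odot>\<^bsub>M\<^esub> v = \<zero>\<^bsub>M\<^esub>"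
  using smult_l_distr[of "\<zero>\<^bsub>R\<^esub>" "\<zero>\<^bsub>R\<^esub>" v] smult_closed[of "\<zero>\<^bsub>R\<^esub>" v]
  by (simp add: M.add.r_cancel_one')

lemma submoduleI:
  assumes "H \<subseteq> carrier M" and "\<zero>\<^bsub>M\<^esub> \<in> H"
    and "\<And>v w. v \<in> H \<Longrightarrow> w \<in> H \<Longrightarrow> v \<oplus>\<^bsub>M\<^esub> w \<in> H"
    and smult: "\<And>a v. a \<in> carrier R \<Longrightarrow> v \<in> H \<Longrightarrow> a \<odot>\<^bsub>M\<^esub> v \<in> H"
  shows "submodule H R M"
proof -
  have inv: "inv\<^bsub>add_monoid M\<^esub> v \<in> H" if v: "v \<in> H" for v
  proof -
    \<comment> \<open>Closure under inverses follows from closure under the scalar \<open>-1\<close>.\<close>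
    let ?w = "(\<ominus>\<^bsub>R\<^esub> \<one>\<^bsub>R\<^esub>) \<odot>\<^bsub>M\<^esub> v"
    have c: "v \<in> carrier M" "?w \<in> carrier M"
      using v assms(1) smult_closed[of "\<ominus>\<^bsub>R\<^esub> \<one>\<^bsub>R\<^esub>" v] by auto
    have "?w \<oplus>\<^bsub>M\<^esub> v = \<zero>\<^bsub>M\<^esub>"
      using smult_l_distr[of "\<ominus>\<^bsub>R\<^esub> \<one>\<^bsub>R\<^esub>" "\<one>\<^bsub>R\<^esub>" v] c
      by (simp add: smult_one zero_smult R.l_neg)
    then have "\<ominus>\<^bsub>M\<^esub> v = ?w"
      using c M.minus_equality by blast
    then show ?thesis
      using smult[of "\<ominus>\<^bsub>R\<^esub> \<one>\<^bsub>R\<^esub>" v] v by (simp add: a_inv_def)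
  qed
  show ?thesis
    using assms inv
    by (auto simp: submodule_def submodule_axioms_def subgroup_def)
qed

end

lemma submoduleD:
  assumes "submodule H R M"
  shows "H \<subseteq> carrier M" and "\<zero>\<^bsub>M\<^esub> \<in> H"
    and "\<And>v w. v \<in> H \<Longrightarrow> w \<in> H \<Longrightarrow> v \<oplus>\<^bsub>M\<^esub> w \<in> H"
    and "\<And>a v. a \<in> carrier R \<Longrightarrow> v \<in> H \<Longrightarrow> a \<odot>\<^bsub>M\<^esub> v \<in> H"
  using assms by (auto simp: submodule_def submodule_axioms_def subgroup_def)

lemma submodule_vimage:
  assumes "left_module R M" and "left_module R N"
    and f: "f \<in> iso (add_monoid M) (add_monoid N)"
    and smult: "\<And>a v. a \<in> carrier R \<Longrightarrow> v \<in> carrier M \<Longrightarrow> f (a \<odot>\<^bsub>M\<^esub> v) = a \<odot>\<^bsub>N\<^esub> f v"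
    and K: "submodule K R N"
  shows "submodule {v \<in> carrier M. f v \<in> K} R M"
proof -
  interpret M: left_module R M by fact
  show ?thesis
  proof (rule M.submoduleI)
    fix a v assume "a \<in> carrier R" "v \<in> {v \<in> carrier M. f v \<in> K}"
    then show "a \<odot>\<^bsub>M\<^esub> v \<in> {v \<in> carrier M. f v \<in> K}"
      using smult submoduleD(4)[OF K] by (simp add: M.smult_closed)
  next
    fix v w assume "v \<in> {v \<in> carrier M. f v \<in> K}" "w \<in> {v \<in> carrier M. f v \<in> K}"
    then show "v \<oplus>\<^bsub>M\<^esub> w \<in> {v \<in> carrier M. f v \<in> K}"
      using isoE_bij(2)[OF f] submoduleD(3)[OF K] by simp
  qed (use iso_zero[OF assms(1,2) f] submoduleD(2)[OF K] in auto)
qed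

lemma irreducible_module_transfer:
  assumes M: "left_module R M" and N: "left_module R N"
    and iso: "module_isomorphic R M N" and irr: "irreducible_module R M"
  shows "irreducible_module R N"
proof -
  obtain f where f: "f \<in> iso (add_monoid M) (add_monoid N)"
    and smult: "\<And>a v. a \<in> carrier R \<Longrightarrow> v \<in> carrier M \<Longrightarrow> f (a \<odot>\<^bsub>M\<^esub> v) = a \<odot>\<^bsub>N\<^esub> f v"
    using iso unfolding module_isomorphic_def by blast
  note zero = iso_zero[OF M N f]
  have img: "f ` carrier M = carrier N" and inj: "inj_on f (carrier M)"
    using isoE_bij(1)[OF f] by (auto simp: bij_betw_def)
  interpret M: left_module R M by (rule M)
  have "carrier N \<noteq> {\<zero>\<^bsub>N\<^esub>}"
  proof
    assume *: "carrier N = {\<zero>\<^bsub>N\<^esub>}"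
    then have "v = \<zero>\<^bsub>M\<^esub>" if "v \<in> carrier M" for v
      using inj_onD[OF inj, of v "\<zero>\<^bsub>M\<^esub>"] that img zero by auto
    then have "carrier M = {\<zero>\<^bsub>M\<^esub>}" by auto
    then show False
      using irr by (simp add: irreducible_module_def)
  qed
  moreover have "K = {\<zero>\<^bsub>N\<^esub>} \<or> K = carrier N" if K: "submodule K R N" for K
  proof -
    let ?H = "{v \<in> carrier M. f v \<in> K}"
    have "K \<subseteq> carrier N"
      using K subgroup.subset[of K "add_monoid N"] by (auto simp: submodule_def)
    then have KH: "K = f ` ?H"
      using img by auto
    have "?H = {\<zero>\<^bsub>M\<^esub>} \<or> ?H = carrier M"
      using irr submodule_vimage[OF M N f smult K] by (auto simp: irreducible_module_def)
    then show ?thesis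
    proof
      assume "?H = {\<zero>\<^bsub>M\<^esub>}"
      then have "K = {\<zero>\<^bsub>N\<^esub>}" using KH zero by (metis image_empty image_insert)
      then show ?thesis ..
    next
      assume "?H = carrier M"
      then have "K = carrier N" using KH img by metis
      then show ?thesis ..
    qed
  qed
  ultimately show ?thesis
    using N by (simp add: irreducible_module_def)
qed

section \<open>Chains of forward-closed sets in a finite digraph\<close>

text \<open>The classes of the kernel relation of \<open>f\<close> are its nonempty fibres.\<close>

lemma card_quotient_kernel:
  "card (A // {(a, b). a \<in> A \<and> b \<in> A \<and> f a = f b}) = card (f ` A)"
proof -
  let ?fibre = "\<lambda>y. {a \<in> A. f a = y}"
  have "A // {(a, b). a \<in> A \<and> b \<in> A \<and> f a = f b} = ?fibre ` f ` A"
    by (auto simp: quotient_def image_image Image_def eq_commute)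
  moreover have "inj_on ?fibre (f ` A)"
    by (rule inj_onI) blast
  ultimately show ?thesis
    by (simp add: card_image)
qed

locale finite_digraph =
  fixes A :: "'a set" and arc :: "'a \<Rightarrow> 'a \<Rightarrow> bool"
  assumes finite: "finite A" and arc_in: "arc i l \<Longrightarrow> i \<in> A \<and> l \<in> A"
begin

definition forward_closed :: "'a set \<Rightarrow> bool" where
  "forward_closed I \<longleftrightarrow> I \<subseteq> A \<and> (\<forall>i\<in>I. \<forall>l. arc i l \<longrightarrow> l \<in> I)"

definition linked :: "('a \<times> 'a) set" where
  "linked = {(i, j). i \<in> A \<and> j \<in> A \<and> arc\<^sup>*\<^sup>* i j \<and> arc\<^sup>*\<^sup>* j i}"

definition components :: "'a set set" where
  "components = A // linked"

lemma equiv_linked: "equiv A linked"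
  by (rule equivI) (auto simp: linked_def refl_on_def sym_def trans_def)

lemma forward_closed_reach:
  assumes "forward_closed I" and "arc\<^sup>*\<^sup>* i l" and "i \<in> I"
  shows "l \<in> I"
  using assms(2,3,1) by (induction) (auto simp: forward_closed_def)

lemma forward_closed_reachable: "i \<in> A \<Longrightarrow> forward_closed {l. arc\<^sup>*\<^sup>* i l}"
  unfolding forward_closed_def
  by (auto elim: rtranclp.cases dest: arc_in intro: rtranclp.rtrancl_into_rtrancl)

lemma forward_closed_Un: "forward_closed I \<Longrightarrow> forward_closed J \<Longrightarrow> forward_closed (I \<union> J)"
  by (auto simp: forward_closed_def)

lemma forward_closed_empty [simp]: "forward_closed {}"
  and forward_closed_vertices [simp]: "forward_closed A"
  by (auto simp: forward_closed_def dest: arc_in)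

lemma forward_closed_subset: "forward_closed I \<Longrightarrow> I \<subseteq> A"
  by (simp add: forward_closed_def)

lemma component_nonempty: "C \<in> components \<Longrightarrow> C \<noteq> {}"
  unfolding components_def using equiv_linked in_quotient_imp_non_empty by blast

lemma component_subset: "C \<in> components \<Longrightarrow> C \<subseteq> A"
  unfolding components_def using equiv_linked in_quotient_imp_subset by blast

lemma component_reach: "C \<in> components \<Longrightarrow> i \<in> C \<Longrightarrow> l \<in> C \<Longrightarrow> arc\<^sup>*\<^sup>* i l"
  unfolding components_def using in_quotient_imp_in_rel[OF equiv_linked, of C i l]
  by (auto simp: linked_def)

lemma components_eq: "C \<in> components \<Longrightarrow> D \<in> components \<Longrightarrow> i \<in> C \<Longrightarrow> i \<in> D \<Longrightarrow> C = D"
  unfolding components_def using quotient_disj[OF equiv_linked] by blast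

text \<open>For every \<open>i \<in> I - J\<close> the set of all vertices that are in \<open>J\<close> or reachable from \<open>i\<close> is closed and
larger than \<open>J\<close>, hence equal to \<open>I\<close>. So any two vertices of \<open>I - J\<close> reach each other, and nothing
outside \<open>I - J\<close> is linked to them because \<open>I\<close> and \<open>J\<close> are closed.\<close>

lemma component_step:
  assumes I: "forward_closed I" and J: "forward_closed J" and sub: "J \<subset> I"
    and max: "\<And>K. forward_closed K \<Longrightarrow> J \<subset> K \<Longrightarrow> K \<subseteq> I \<Longrightarrow> K = I"
  shows "I - J \<in> components"
proof -
  have IA: "I \<subseteq> A" using I by (simp add: forward_closed_def)
  have reach: "arc\<^sup>*\<^sup>* i l" if i: "i \<in> I - J" and l: "l \<in> I - J" for i l
  proof -
    have "{l. arc\<^sup>*\<^sup>* i l} \<subseteq> I"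
      using forward_closed_reach[OF I] i by auto
    moreover have "forward_closed (J \<union> {l. arc\<^sup>*\<^sup>* i l})"
      using forward_closed_Un[OF J forward_closed_reachable] i IA by blast
    moreover have "J \<subset> J \<union> {l. arc\<^sup>*\<^sup>* i l}"
      using i by auto
    ultimately have "J \<union> {l. arc\<^sup>*\<^sup>* i l} = I"
      using max sub by blast
    then show ?thesis using l by auto
  qed
  obtain i where i: "i \<in> I - J" using sub by auto
  have "linked `` {i} = I - J"
  proof (intro equalityI subsetI)
    fix l assume "l \<in> linked `` {i}"
    then have "arc\<^sup>*\<^sup>* i l" "arc\<^sup>*\<^sup>* l i" by (auto simp: linked_def)
    then show "l \<in> I - J"
      using i forward_closed_reach[OF I, of i l] forward_closed_reach[OF J, of l i] by auto
  next
    fix l assume "l \<in> I - J"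
    then show "l \<in> linked `` {i}"
      using i reach IA by (auto simp: linked_def)
  qed
  moreover have "i \<in> A" using i IA by auto
  ultimately show ?thesis
    unfolding components_def using quotientI by metis
qed

lemma no_closed_between:
  assumes "I - J \<in> components" and K: "forward_closed K" and "J \<subseteq> K" "K \<subseteq> I"
  shows "K = J \<or> K = I"
proof (rule ccontr)
  assume "\<not> (K = J \<or> K = I)"
  then obtain i l where "i \<in> K - J" "l \<in> I - K" using assms by auto
  then show False
    using component_reach[OF assms(1), of i l] forward_closed_reach[OF K, of i l] assms by auto
qed

text \<open>A chain that cannot be refined; only the values \<open>S 0, \<dots>, S n\<close> matter.\<close>

definition closed_chain :: "(nat \<Rightarrow> 'a set) \<Rightarrow> nat \<Rightarrow> bool" where
  "closed_chain S n \<longleftrightarrow> S 0 = {} \<and> (\<forall>k\<le>n. forward_closed (S k)) \<and>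
     (\<forall>k<n. S k \<subset> S (Suc k) \<and> S (Suc k) - S k \<in> components)"

text \<open>Below a nonempty closed set \<open>I\<close> a closed proper subset of largest cardinality is maximal, so the
last step of the chain is a component; the rest comes by induction on the size of \<open>I\<close>.\<close>

lemma closed_chain_exists:
  assumes "forward_closed I"
  shows "\<exists>S n. closed_chain S n \<and> S n = I"
  using assms
proof (induction "card I" arbitrary: I rule: less_induct)
  case less
  have finI: "finite I" using less.prems finite finite_subset by (auto simp: forward_closed_def)
  show ?case
  proof (cases "I = {}")
    case True
    then show ?thesis
      by (intro exI[of _ "\<lambda>_. {}"] exI[of _ 0]) (simp add: closed_chain_def)
  next
    case False
    let ?P = "\<lambda>J. forward_closed J \<and> J \<subset> I"
    have "\<exists>J. ?P J \<and> (\<forall>K. ?P K \<longrightarrow> card K \<le> card J)"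
    proof (rule ex_has_greatest_nat[where P = ?P and f = card and k = "{}" and b = "Suc (card I)"])
      show "?P {}" using False by auto
      show "\<forall>K. ?P K \<longrightarrow> card K < Suc (card I)" using finI by (auto simp: less_Suc_eq_le intro: card_mono)
    qed
    then obtain J where J: "forward_closed J" "J \<subset> I"
      and greatest: "\<And>K. forward_closed K \<Longrightarrow> K \<subset> I \<Longrightarrow> card K \<le> card J"
      by blast
    have comp: "I - J \<in> components"
    proof (rule component_step[OF less.prems J])
      fix K assume K: "forward_closed K" "J \<subset> K" "K \<subseteq> I"
      then have "card J < card K"
        using finI by (meson finite_subset psubset_card_mono)
      then show "K = I"
        using greatest[OF K(1)] K(3) by (auto simp: psubset_eq)
    qed
    have "card J < card I" using J(2) finI by (rule psubset_card_mono[rotated])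
    from less.hyps[OF this J(1)] obtain S n where S: "closed_chain S n" "S n = J" by blast
    have "closed_chain (S(Suc n := I)) (Suc n)"
      using S J less.prems comp unfolding closed_chain_def
      by (auto simp: le_Suc_eq less_Suc_eq)
    then show ?thesis
      by (intro exI[of _ "S(Suc n := I)"] exI[of _ "Suc n"]) simp
  qed
qed

text \<open>The steps are disjoint and cover all vertices. A vertex of a given component lies in
some step; that step is itself a component, so the two coincide. Hence all maximal chains have the
same steps up to order, which plays the part of the Jordan-Hoelder theorem here.\<close>

lemma closed_chain_bij:
  assumes S: "closed_chain S n" and top: "S n = A"
  shows "bij_betw (\<lambda>k. S (Suc k) - S k) {..<n} components"
proof -
  have mono: "S k \<subseteq> S m" if "k \<le> m" "m \<le> n" for k m
    using that
  proof (induction m rule: nat_induct)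
    case (Suc m)
    then show ?case
      using S by (cases "k = Suc m") (simp_all add: closed_chain_def Suc_le_eq, blast)
  qed simp
  have ne: "S (Suc k) - S k \<noteq> {}" if "k < n" for k
    using S that by (auto simp: closed_chain_def)
  have "inj_on (\<lambda>k. S (Suc k) - S k) {..<n}"
  proof (rule linorder_inj_onI)
    fix k m assume "k < m" "k \<in> {..<n}" "m \<in> {..<n}"
    then show "S (Suc k) - S k \<noteq> S (Suc m) - S m"
      using mono[of "Suc k" m] ne[of k] by auto
  qed auto
  moreover have "C \<in> (\<lambda>k. S (Suc k) - S k) ` {..<n}" if C: "C \<in> components" for C
  proof -
    obtain i where i: "i \<in> C" using component_nonempty[OF C] by auto
    then have "i \<in> S n" using component_subset[OF C] top by auto
    moreover have "\<not> i \<in> S 0" using S by (simp add: closed_chain_def)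
    ultimately obtain k where k: "k < n" "i \<notin> S k" "i \<in> S (Suc k)"
      using ex_least_nat_less[of "\<lambda>k. i \<in> S k" n] by auto
    have "S (Suc k) - S k \<in> components" using S k by (simp add: closed_chain_def)
    from components_eq[OF C this i] k show ?thesis by auto
  qed
  moreover have "(\<lambda>k. S (Suc k) - S k) ` {..<n} \<subseteq> components"
    using S by (auto simp: closed_chain_def)
  ultimately show ?thesis
    by (auto simp: bij_betw_def)
qed

end

section \<open>Intersection numbers and cells of an association scheme\<close>

locale scheme_with_base =
  fixes d :: nat and R :: "nat \<Rightarrow> ('x::finite \<times> 'x) set" and x :: 'x
  assumes scheme: "association_scheme d R"
begin

abbreviation conv :: "nat \<Rightarrow> nat" where
  "conv \<equiv> converse_index d R"

abbreviation inum :: "nat \<Rightarrow> nat \<Rightarrow> nat \<Rightarrow> nat" where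
  "inum \<equiv> intersection_number R"

abbreviation val :: "nat \<Rightarrow> nat" where
  "val \<equiv> valency d R"

lemma relation_nonempty: "i \<le> d \<Longrightarrow> R i \<noteq> {}"
  using scheme by (auto simp: association_scheme_def partition_on_def)

lemma relation_unique:
  assumes "(y, z) \<in> R i" "(y, z) \<in> R j" "i \<le> d" "j \<le> d"
  shows "i = j"
proof -
  have "R i = R j"
    using scheme assms by (auto simp: association_scheme_def partition_on_def disjoint_def)
  then show ?thesis
    using scheme assms(3,4) by (auto simp: association_scheme_def inj_on_def)
qed

lemma relation_exists: "\<exists>i\<le>d. (y, z) \<in> R i"
proof -
  have "(y, z) \<in> \<Union> (R ` {..d})"
    using scheme by (auto simp: association_scheme_def partition_on_def)
  then show ?thesis by auto
qed

lemma relation_zero: "(y, z) \<in> R 0 \<longleftrightarrow> y = z"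
  using scheme by (auto simp: association_scheme_def)

lemma converse_index:
  assumes "i \<le> d"
  shows "conv i \<le> d" and "(y, z) \<in> R (conv i) \<longleftrightarrow> (z, y) \<in> R i"
proof -
  obtain i' where i': "i' \<le> d" "R i' = {(y, z). (z, y) \<in> R i}"
    using scheme assms unfolding association_scheme_def by blast
  have "conv i = i'"
    unfolding converse_index_def
  proof (rule the_equality)
    fix k assume k: "k \<le> d \<and> R k = {(y, z). (z, y) \<in> R i}"
    have "inj_on R {..d}" using scheme by (simp add: association_scheme_def)
    then show "k = i'" using k i' by (intro inj_onD[of R "{..d}"]) auto
  qed (use i' in auto)
  then show "conv i \<le> d" and "(y, z) \<in> R (conv i) \<longleftrightarrow> (z, y) \<in> R i"
    using i' by auto
qed

lemma intersection_number:
  assumes "i \<le> d" "j \<le> d" "l \<le> d" and yz: "(y, z) \<in> R l"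
  shows "inum i j l = card {w. (y, w) \<in> R i \<and> (w, z) \<in> R j}"
proof -
  have "\<exists>n. \<forall>(y, z)\<in>R l. card {w. (y, w) \<in> R i \<and> (w, z) \<in> R j} = n"
    using scheme assms unfolding association_scheme_def by blast
  then obtain n where n: "\<forall>(y, z)\<in>R l. card {w. (y, w) \<in> R i \<and> (w, z) \<in> R j} = n" ..
  have "inum i j l = n"
    unfolding intersection_number_def
    by (rule the_equality) (use n yz in fastforce)+
  then show ?thesis using n yz by auto
qed

lemma valency: "i \<le> d \<Longrightarrow> val i = card {w. (y, w) \<in> R i}"
  using intersection_number[of i "conv i" 0 y y] converse_index[of i]
  by (simp add: valency_def relation_zero)

lemma neighbour_exists:
  assumes "i \<le> d" shows "\<exists>w. (y, w) \<in> R i"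
proof -
  obtain u v where "(u, v) \<in> R i" using relation_nonempty[OF assms] by auto
  then have "0 < card {w. (u, w) \<in> R i}" by (auto simp: card_gt_0_iff)
  then have "0 < card {w. (y, w) \<in> R i}" using valency[OF assms] by metis
  then show ?thesis by (auto simp: card_gt_0_iff)
qed

lemma valency_pos: "i \<le> d \<Longrightarrow> 0 < val i"
  using valency[of i x] neighbour_exists[of i x] by (auto simp: card_gt_0_iff)

text \<open>Both sides count the pairs \<open>(y, z)\<close> in \<open>R\<^sub>j\<close> with \<open>y\<close> in the cell \<open>x R\<^sub>l\<close> and \<open>z\<close> in the cell
\<open>x R\<^sub>i\<close>, the left side grouped by \<open>y\<close> and the right side by \<open>z\<close>.\<close>

lemma valency_mult_intersection_number:
  assumes "i \<le> d" "j \<le> d" "l \<le> d"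
  shows "val l * inum i (conv j) l = val i * inum l j i"
proof -
  let ?L = "{y. (x, y) \<in> R l}" and ?I = "{z. (x, z) \<in> R i}"
  have "(\<Sum>y\<in>?L. card {z \<in> ?I. (y, z) \<in> R j}) = (\<Sum>z\<in>?I. inum l j i)"
    by (rule sum_multicount_gen) (use assms in \<open>auto simp: intersection_number\<close>)
  moreover have "card {z \<in> ?I. (y, z) \<in> R j} = inum i (conv j) l" if "y \<in> ?L" for y
    using that assms converse_index[of j] by (simp add: intersection_number[of i "conv j" l x y])
  ultimately show ?thesis
    using assms valency[of _ x] by simp
qed

text \<open>This is what makes the chain relation reflexive: it provides the chain of length one from \<open>i\<close>
to itself.\<close>

lemma intersection_number_identity: "i \<le> d \<Longrightarrow> inum i (conv 0) i = 1"
proof -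
  assume i: "i \<le> d"
  then obtain w where "(x, w) \<in> R i" using neighbour_exists by blast
  then have "{u. (x, u) \<in> R i \<and> (u, w) \<in> R (conv 0)} = {w}"
    using converse_index[of 0] by (auto simp: relation_zero)
  then show ?thesis
    using intersection_number[of i "conv 0" i x w] i \<open>(x, w) \<in> R i\<close> converse_index(1)[of 0] by simp
qed

text \<open>The cells \<open>x R\<^sub>i\<close> partition the points, so a point determines its index.\<close>

definition cell :: "'x \<Rightarrow> nat" where
  "cell y = (THE i. i \<le> d \<and> (x, y) \<in> R i)"

lemma cell: "cell y \<le> d" "(x, y) \<in> R (cell y)"
proof -
  have "\<exists>!i. i \<le> d \<and> (x, y) \<in> R i"
    using relation_exists[of x y] relation_unique by blast
  from theI'[OF this] show "cell y \<le> d" "(x, y) \<in> R (cell y)"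
    by (simp_all add: cell_def)
qed

lemma cell_iff: "i \<le> d \<Longrightarrow> (x, y) \<in> R i \<longleftrightarrow> cell y = i"
  using cell[of y] relation_unique by blast

lemma cell_surj: "i \<le> d \<Longrightarrow> \<exists>y. cell y = i"
  using neighbour_exists[of i x] cell_iff by blast

end

section \<open>Strongly connected components modulo a prime\<close>

locale modular_scheme = scheme_with_base d R x
  for d :: nat and R :: "nat \<Rightarrow> ('x::finite \<times> 'x) set" and x :: 'x +
  fixes p :: nat
  assumes prime: "prime p"
begin

text \<open>An arc from \<open>i\<close> to \<open>l\<close> says that some \<open>E\<^sub>l\<^sup>* A\<^sub>j\<close> sends \<open>E\<^sub>i\<^sup>* \<one>\<close> to a nonzero multiple of
\<open>E\<^sub>l\<^sup>* \<one>\<close>.\<close>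

definition arc :: "nat \<Rightarrow> nat \<Rightarrow> bool" where
  "arc i l \<longleftrightarrow> i \<le> d \<and> l \<le> d \<and> (\<exists>j\<le>d. \<not> p dvd inum i (conv j) l)"

sublocale finite_digraph "{..d}" arc
  by unfold_locales (auto simp: arc_def)

text \<open>Chains run against the arcs: the factor at position \<open>a\<close> of the product is an arc from \<open>ls a\<close> to
\<open>us a\<close>.\<close>

lemma chain_related_imp_reach:
  assumes "chain_related p d R i j"
  shows "arc\<^sup>*\<^sup>* j i"
proof -
  obtain m :: nat and us js ls where
    bounds: "\<forall>a\<le>m. us a \<le> d \<and> js a \<le> d \<and> ls a \<le> d"
    and ends: "us 0 = i" "ls m = j"
    and prod: "\<not> p dvd (\<Prod>a=0..m. inum (ls a) (conv (js a)) (us a))"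
    and link: "\<forall>b\<in>{1..m}. ls (b - 1) = us b"
    using assms unfolding chain_related_def by blast
  have arc: "arc (ls a) (us a)" if "a \<le> m" for a
  proof -
    have "\<not> p dvd inum (ls a) (conv (js a)) (us a)"
    proof
      assume "p dvd inum (ls a) (conv (js a)) (us a)"
      also have "\<dots> dvd (\<Prod>a=0..m. inum (ls a) (conv (js a)) (us a))"
        using that by (intro dvd_prodI) auto
      finally show False using prod by simp
    qed
    then show ?thesis using bounds that by (auto simp: arc_def)
  qed
  have "arc\<^sup>*\<^sup>* (ls a) i" if "a \<le> m" for a
    using that
  proof (induction a)
    case 0
    then show ?case using arc[of 0] ends by auto
  next
    case (Suc a)
    have "ls a = us (Suc a)" using link Suc.prems by (auto dest: bspec[of _ _ "Suc a"])
    then show ?case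
      using arc[OF Suc.prems] Suc by (auto intro: converse_rtranclp_into_rtranclp)
  qed
  then show ?thesis using ends by auto
qed

lemma reach_imp_chain_related:
  assumes "arc\<^sup>*\<^sup>* j i" and i: "i \<le> d"
  shows "chain_related p d R i j"
  using assms(1)
proof (induction rule: converse_rtranclp_induct)
  case base
  have "p \<noteq> 1" using prime by auto
  then show ?case
    unfolding chain_related_def
    by (intro exI[of _ "0::nat"] exI[of _ "\<lambda>_. i"] exI[of _ "\<lambda>_. 0"])
      (use i in \<open>auto simp: intersection_number_identity\<close>)
next
  case (step j k)
  obtain t where t: "t \<le> d" "\<not> p dvd inum j (conv t) k" and jk: "j \<le> d" "k \<le> d"
    using step.hyps(1) by (auto simp: arc_def)
  obtain m :: nat and us js ls where
    bounds: "\<forall>a\<le>m. us a \<le> d \<and> js a \<le> d \<and> ls a \<le> d"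
    and ends: "us 0 = i" "ls m = k"
    and prod: "\<not> p dvd (\<Prod>a=0..m. inum (ls a) (conv (js a)) (us a))"
    and link: "\<forall>b\<in>{1..m}. ls (b - 1) = us b"
    using step.IH unfolding chain_related_def by blast
  \<comment> \<open>The new arc starts at \<open>j\<close>, so it is appended at the far end of the chain.\<close>
  let ?us = "us(Suc m := k)" and ?js = "js(Suc m := t)" and ?ls = "ls(Suc m := j)"
  have "(\<Prod>a=0..m. inum (?ls a) (conv (?js a)) (?us a)) = (\<Prod>a=0..m. inum (ls a) (conv (js a)) (us a))"
    by (rule prod.cong) auto
  then have "\<not> p dvd (\<Prod>a=0..Suc m. inum (?ls a) (conv (?js a)) (?us a))"
    using prod t prime by (simp add: prime_dvd_mult_iff)
  moreover have "\<forall>a\<le>Suc m. ?us a \<le> d \<and> ?js a \<le> d \<and> ?ls a \<le> d"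
    using bounds t jk by (simp add: le_Suc_eq)
  moreover have "\<forall>b\<in>{1..Suc m}. ?ls (b - 1) = ?us b"
    using link ends by (auto simp: le_Suc_eq)
  moreover have "?us 0 = i" "?ls (Suc m) = j" using ends by auto
  ultimately show ?case
    unfolding chain_related_def by blast
qed

lemma sim_iff_linked:
  assumes "i \<le> d" "j \<le> d"
  shows "sim p d R i j \<longleftrightarrow> (i, j) \<in> linked"
  using assms chain_related_imp_reach reach_imp_chain_related
  by (auto simp: sim_def linked_def)

text \<open>The index set of \<open>W\<^sub>n\<close>.\<close>

definition divisible :: "nat \<Rightarrow> nat set" where
  "divisible n = {i. i \<le> d \<and> p ^ n dvd val i}"

lemma S_set_eq: "S_set p d R n = divisible n - divisible (Suc n)"
  by (auto simp: S_set_def divisible_def)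

lemma divisible_Suc: "divisible (Suc n) \<subseteq> divisible n"
  by (auto simp: divisible_def intro: dvd_mult_right)

text \<open>Double counting gives \<open>k\<^sub>i dvd k\<^sub>l c\<close> with an intersection number \<open>c\<close> that is prime to \<open>p\<close> when
the arc from \<open>i\<close> to \<open>l\<close> comes from it.\<close>

lemma forward_closed_divisible: "forward_closed (divisible n)"
  unfolding forward_closed_def
proof (intro conjI ballI allI impI)
  fix i l assume i: "i \<in> divisible n" and "arc i l"
  then obtain j where j: "i \<le> d" "l \<le> d" "j \<le> d" and ndvd: "\<not> p dvd inum i (conv j) l"
    by (auto simp: arc_def)
  have "p ^ n dvd val l * inum i (conv j) l"
    using i unfolding valency_mult_intersection_number[OF j(1,3,2)]
    by (simp add: divisible_def)
  moreover have "coprime (p ^ n) (inum i (conv j) l)"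
    using prime ndvd by (simp add: prime_imp_coprime)
  ultimately show "l \<in> divisible n"
    using j by (simp add: divisible_def coprime_dvd_mult_left_iff)
qed (auto simp: divisible_def)

text \<open>When both valencies have the same \<open>p\<close>-part, cancelling it in the double counting identity
leaves two factors prime to \<open>p\<close> on one side, so the intersection number on the other side is prime
to \<open>p\<close> too.\<close>

lemma arc_sym_S_set:
  assumes i: "i \<in> S_set p d R n" and l: "l \<in> S_set p d R n" and "arc i l"
  shows "arc l i"
proof -
  obtain j where j: "i \<le> d" "l \<le> d" "j \<le> d" and ndvd: "\<not> p dvd inum i (conv j) l"
    using assms(3) by (auto simp: arc_def)
  obtain a where a: "val l = p ^ n * a" using l by (auto simp: S_set_def)
  obtain b where b: "val i = p ^ n * b" using i by (auto simp: S_set_def)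
  have "\<not> p dvd a" using l prime a by (auto simp: S_set_def)
  have "p ^ n * (a * inum i (conv j) l) = p ^ n * (b * inum l j i)"
    using valency_mult_intersection_number[OF j(1,3,2)] a b by (simp add: mult.assoc)
  then have "a * inum i (conv j) l = b * inum l j i"
    using prime by (simp add: prime_gt_0_nat)
  then have "\<not> p dvd inum l j i"
    using \<open>\<not> p dvd a\<close> ndvd prime by (metis dvd_mult prime_dvd_mult_iff)
  moreover have "conv (conv j) = j"
  proof -
    obtain y z where yz: "(y, z) \<in> R j" using relation_nonempty[OF j(3)] by auto
    have "conv j \<le> d" "conv (conv j) \<le> d"
      using converse_index(1) j(3) by auto
    then have "(y, z) \<in> R (conv (conv j))"
      using yz converse_index(2) j(3) by simp
    then show ?thesis
      using relation_unique yz j(3) \<open>conv (conv j) \<le> d\<close> by blast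
  qed
  ultimately show ?thesis
    using j converse_index(1)[of j] by (auto simp: arc_def intro!: exI[of _ "conv j"])
qed

lemma linked_S_set:
  assumes "i \<in> S_set p d R n" "(i, l) \<in> linked"
  shows "l \<in> S_set p d R n"
  using assms forward_closed_reach[OF forward_closed_divisible, of i l n]
    forward_closed_reach[OF forward_closed_divisible, of l i "Suc n"]
  by (auto simp: S_set_eq linked_def)

lemma Q_classes_eq: "Q_classes p d R n = (\<lambda>i. linked `` {i}) ` S_set p d R n"
proof -
  let ?r = "{(i, j). i \<in> S_set p d R n \<and> j \<in> S_set p d R n \<and> sim p d R i j}"
  have "?r `` {i} = linked `` {i}" if "i \<in> S_set p d R n" for i
    using that linked_S_set[OF that] sim_iff_linked
    by (auto simp: S_set_def linked_def)
  then show ?thesis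
    unfolding Q_classes_def quotient_def by auto
qed

lemma Q_class:
  assumes "C \<in> Q_classes p d R n"
  shows "C \<in> components" and "C \<subseteq> S_set p d R n"
proof -
  obtain i where i: "i \<in> S_set p d R n" "C = linked `` {i}"
    using assms by (auto simp: Q_classes_eq)
  then show "C \<subseteq> S_set p d R n" using linked_S_set by blast
  have "i \<in> {..d}" using i by (simp add: S_set_def)
  then show "C \<in> components" unfolding components_def i(2) by (rule quotientI)
qed

lemma finite_exponents: "finite {m. \<exists>i\<le>d. p ^ m dvd val i}"
proof (rule finite_subset)
  show "{m. \<exists>i\<le>d. p ^ m dvd val i} \<subseteq> {..Max (val ` {..d})}"
  proof (clarsimp)
    fix m i assume i: "i \<le> d" and "p ^ m dvd val i"
    then have "p ^ m \<le> val i" using valency_pos by (simp add: dvd_imp_le)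
    moreover have "m < p ^ m" using power_gt_expt prime_gt_Suc_0_nat[OF prime] by blast
    moreover have "val i \<le> Max (val ` {..d})" using i by simp
    ultimately show "m \<le> Max (val ` {..d})" by linarith
  qed
qed simp

lemma exponent_exists:
  assumes "i \<le> d" shows "\<exists>n\<in>Q_index p d R. i \<in> S_set p d R n"
proof -
  define n where "n = multiplicity p (val i)"
  have "val i \<noteq> 0" "\<not> is_unit p" using valency_pos[OF assms] prime by auto
  then have "\<not> p ^ (n + 1) dvd val i"
    by (simp add: n_def power_dvd_iff_le_multiplicity del: power_Suc)
  then have S: "i \<in> S_set p d R n"
    using assms by (simp add: S_set_def n_def multiplicity_dvd)
  have "n \<le> epsilon p d R"
    unfolding epsilon_def
    by (rule Max_ge[OF finite_exponents]) (use S in \<open>auto simp: S_set_def\<close>)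
  then have "n \<in> Q_index p d R"
    using S by (auto simp: Q_index_def Q_classes_eq)
  then show ?thesis using S by blast
qed

lemma S_set_disjoint:
  assumes "i \<in> S_set p d R m" "i \<in> S_set p d R n" shows "m = n"
proof -
  have "\<not> m < n" if "i \<in> S_set p d R m" "i \<in> S_set p d R n" for m n
  proof
    assume "m < n"
    then have "p ^ (m + 1) dvd p ^ n" by (intro le_imp_power_dvd) simp
    then show False using that dvd_trans unfolding S_set_def by blast
  qed
  then show ?thesis using assms by (meson linorder_neqE_nat)
qed

lemma Q_classes_disjoint:
  assumes "C \<in> Q_classes p d R m" and "C \<in> Q_classes p d R n"
  shows "m = n"
proof -
  obtain i where "i \<in> C" using component_nonempty[OF Q_class(1)[OF assms(1)]] by auto
  then show ?thesis
    using Q_class(2)[OF assms(1)] Q_class(2)[OF assms(2)] S_set_disjoint by blast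
qed

text \<open>Restricting the relation to \<open>S\<^sub>n\<close> does not cut any class, and the sets \<open>S\<^sub>n\<close> with index up to
\<open>\<epsilon>\<close> cover all indices.\<close>

lemma components_eq_Q_classes: "components = (\<Union>q\<in>Q_index p d R. Q_classes p d R q)"
proof
  show "components \<subseteq> (\<Union>q\<in>Q_index p d R. Q_classes p d R q)"
  proof
    fix C assume "C \<in> components"
    then obtain i where i: "i \<le> d" "C = linked `` {i}"
      by (auto simp: components_def elim: quotientE)
    from exponent_exists[OF i(1)] show "C \<in> (\<Union>q\<in>Q_index p d R. Q_classes p d R q)"
      using i(2) unfolding Q_classes_eq by blast
  qed
qed (use Q_class in auto)

lemma finite_components: "Finite_Set.finite components"
  by (simp add: components_def quotient_def)

lemma card_components: "(\<Sum>q\<in>Q_index p d R. card (Q_classes p d R q)) = card components"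
  unfolding components_eq_Q_classes
proof (rule card_UN_disjoint[symmetric])
  show "Finite_Set.finite (Q_index p d R)" by (simp add: Q_index_def)
  show "\<forall>q\<in>Q_index p d R. Finite_Set.finite (Q_classes p d R q)"
    using finite_components unfolding components_eq_Q_classes
    by (meson UN_upper finite_subset)
  show "\<forall>m\<in>Q_index p d R. \<forall>n\<in>Q_index p d R. m \<noteq> n \<longrightarrow> Q_classes p d R m \<inter> Q_classes p d R n = {}"
    using Q_classes_disjoint by blast
qed

text \<open>An arc leaving \<open>C\<close> leads into \<open>W\<^sub>n\<close>. Either its end lies in \<open>W\<^bsub>n+1\<^esub>\<close>, or it lies in \<open>S\<^sub>n\<close> and the arc
can be reversed, so that the end is linked to its start and belongs to \<open>C\<close>. This is why
\<open>Irr\<^sub>n(C)\<close> is a submodule of \<open>W\<^sub>n / W\<^bsub>n+1\<^esub>\<close>.\<close>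

lemma forward_closed_Q_class:
  assumes C: "C \<in> Q_classes p d R n"
  shows "forward_closed (C \<union> divisible (Suc n))"
  unfolding forward_closed_def
proof (intro conjI ballI allI impI)
  show "C \<union> divisible (Suc n) \<subseteq> {..d}"
    using Q_class(2)[OF C] by (auto simp: S_set_def divisible_def)
  fix i l assume i: "i \<in> C \<union> divisible (Suc n)" and arc: "arc i l"
  show "l \<in> C \<union> divisible (Suc n)"
  proof (cases "i \<in> divisible (Suc n) \<or> l \<in> divisible (Suc n)")
    case True
    then show ?thesis
      using forward_closed_divisible[of "Suc n"] arc by (auto simp: forward_closed_def)
  next
    case False
    then have iC: "i \<in> C" and iS: "i \<in> S_set p d R n"
      using i Q_class(2)[OF C] by auto
    have "l \<in> divisible n"
      using forward_closed_divisible[of n] arc iS by (auto simp: forward_closed_def S_set_eq)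
    then have "arc l i"
      using False arc_sym_S_set[OF iS _ arc] by (auto simp: S_set_eq)
    then have "(i, l) \<in> linked"
      using arc by (auto simp: linked_def dest: arc_in)
    then have "l \<in> C"
      using iC Q_class(1)[OF C] equiv_linked unfolding components_def
      by (meson in_quotient_imp_closed)
    then show ?thesis by simp
  qed
qed

end

section \<open>Matrix rings and cosets of subspaces\<close>

lemma unital_subalgebra_hull: "unital_subalgebra (unital_subalgebra hull G)"
  by (rule hull_in) (auto simp: unital_subalgebra_def)

lemma map_matrix_scale_vector:
  fixes a :: "'f::field ^ 'x::finite ^ 'x"
  shows "map_matrix (\<lambda>b. c * b) a *v v = c *s (a *v v)"
  by (simp add: vec_eq_iff matrix_vector_mult_def map_matrix_def sum_distrib_left mult.assoc)

lemma mat_vector: "mat c *v v = c *s (v :: 'f::field ^ 'x::finite)"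
proof -
  have "mat c = map_matrix (\<lambda>b. c * b) (mat 1 :: 'f ^ 'x ^ 'x)"
    by (simp add: vec_eq_iff mat_def map_matrix_def)
  then show ?thesis by (simp add: map_matrix_scale_vector)
qed

lemma ring_matrix_ring:
  fixes \<A> :: "('f::field ^ 'x::finite ^ 'x) set"
  assumes "unital_subalgebra \<A>"
  shows "ring (matrix_ring \<A>)"
proof (rule ringI)
  have zero: "0 \<in> \<A>"
  proof -
    have "map_matrix (\<lambda>a. 0 * a) (mat 1 :: 'f ^ 'x ^ 'x) \<in> \<A>"
      using assms unfolding unital_subalgebra_def by blast
    also have "map_matrix (\<lambda>a. 0 * a) (mat 1 :: 'f ^ 'x ^ 'x) = 0"
      by (simp add: vec_eq_iff map_matrix_def)
    finally show ?thesis .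
  qed
  have neg: "- A \<in> \<A>" if "A \<in> \<A>" for A
  proof -
    have "map_matrix (\<lambda>a. (-1) * a) A \<in> \<A>"
      using assms that unfolding unital_subalgebra_def by blast
    also have "map_matrix (\<lambda>a. (-1) * a) A = - A"
      by (simp add: vec_eq_iff map_matrix_def)
    finally show ?thesis .
  qed
  show "abelian_group (matrix_ring \<A>)"
  proof (rule abelian_groupI)
    fix A assume "A \<in> carrier (matrix_ring \<A>)"
    then show "\<exists>B\<in>carrier (matrix_ring \<A>). B \<oplus>\<^bsub>matrix_ring \<A>\<^esub> A = \<zero>\<^bsub>matrix_ring \<A>\<^esub>"
      using neg by (intro bexI[of _ "- A"]) (auto simp: matrix_ring_def)
  qed (use assms zero in \<open>auto simp: matrix_ring_def unital_subalgebra_def algebra_simps\<close>)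
  show "Group.monoid (matrix_ring \<A>)"
    by (rule monoidI) (use assms in \<open>auto simp: matrix_ring_def unital_subalgebra_def matrix_mul_assoc\<close>)
qed (auto simp: matrix_ring_def matrix_add_ldistrib matrix_matrix_mult_def vec_eq_iff sum.distrib algebra_simps)

text \<open>The coset \<open>N + v\<close>, freed from the module record that the library operation refers to.\<close>

definition coset :: "('f::field ^ 'x::finite) set \<Rightarrow> 'f ^ 'x \<Rightarrow> ('f ^ 'x) set" where
  "coset N v = (\<lambda>h. h + v) ` N"

lemma column_module_simps [simp]:
  "carrier (column_module U) = U" "zero (column_module U) = 0"
  "add (column_module U) = (+)" "smult (column_module U) = (*v)"
  by (simp_all add: column_module_def)

lemma a_r_coset_column_module: "a_r_coset (column_module U) N v = coset N v"
  by (auto simp: a_r_coset_def' coset_def)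

lemma quotient_column_module:
  "quotient_module (column_module U) N =
     \<lparr>carrier = coset N ` U, monoid.mult = undefined, one = undefined, zero = N,
      add = set_add (column_module U), smult = (\<lambda>a K. \<Union>v\<in>K. coset N (a *v v))\<rparr>"
  by (auto simp: quotient_module_def A_RCOSETS_def' a_r_coset_column_module)

lemma mem_coset: "w \<in> coset N v \<longleftrightarrow> w - v \<in> N"
  unfolding coset_def by (auto intro: image_eqI[of _ _ "w - v"])

lemma coset_eq:
  assumes "vec.subspace N" shows "coset N v = coset N w \<longleftrightarrow> v - w \<in> N"
proof
  assume "coset N v = coset N w"
  moreover have "v \<in> coset N v" using assms by (simp add: mem_coset vec.subspace_0)
  ultimately show "v - w \<in> N" by (simp add: mem_coset)
next
  assume vw: "v - w \<in> N"
  show "coset N v = coset N w"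
  proof (rule Set.set_eqI)
    fix u
    show "u \<in> coset N v \<longleftrightarrow> u \<in> coset N w"
      using vec.subspace_add[OF assms _ vw, of "u - v"] vec.subspace_diff[OF assms _ vw, of "u - w"]
      by (auto simp: mem_coset)
  qed
qed

lemma coset_zero: "vec.subspace N \<Longrightarrow> v \<in> N \<Longrightarrow> coset N v = N"
  using coset_eq[of N v 0] by (simp add: coset_def)

lemma set_add_coset:
  assumes N: "vec.subspace N"
  shows "set_add (column_module U) (coset N v) (coset N w) = coset N (v + w)"
proof (intro equalityI subsetI)
  fix u assume "u \<in> set_add (column_module U) (coset N v) (coset N w)"
  then obtain a b where "a \<in> coset N v" "b \<in> coset N w" and u: "u = a + b"
    by (auto simp: set_add_def')
  then have "(a - v) + (b - w) \<in> N"
    using vec.subspace_add[OF N] by (simp add: mem_coset)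
  then show "u \<in> coset N (v + w)"
    using u by (simp add: mem_coset algebra_simps)
next
  fix u assume "u \<in> coset N (v + w)"
  then have "u - w \<in> coset N v" "w \<in> coset N w" "u = (u - w) + w"
    using N by (auto simp: mem_coset vec.subspace_0 algebra_simps)
  then show "u \<in> set_add (column_module U) (coset N v) (coset N w)"
    unfolding set_add_def' by (intro UN_I[of "u - w"] UN_I[of w]) auto
qed

text \<open>The action on a quotient is well defined: it does not depend on the representative.\<close>

lemma smult_coset:
  assumes N: "vec.subspace N" and stable: "\<And>u. u \<in> N \<Longrightarrow> a *v u \<in> N"
  shows "(\<Union>u\<in>coset N v. coset N (a *v u)) = coset N (a *v v)"
proof -
  have "coset N (a *v u) = coset N (a *v v)" if "u \<in> coset N v" for u
  proof -
    have "a *v (u - v) \<in> N" using that stable by (simp add: mem_coset)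
    then show ?thesis
      unfolding coset_eq[OF N] by (simp add: matrix_vector_mult_diff_distrib)
  qed
  then have "(\<Union>u\<in>coset N v. coset N (a *v u)) = (\<Union>u\<in>coset N v. coset N (a *v v))"
    by (rule SUP_cong[OF refl])
  moreover have "v \<in> coset N v" using N by (simp add: mem_coset vec.subspace_0)
  ultimately show ?thesis by blast
qed

section \<open>The action of the Terwilliger algebra on cell functions\<close>

locale terwilliger = modular_scheme d R x p
  for d :: nat and R :: "nat \<Rightarrow> ('x::finite \<times> 'x) set" and x :: 'x and p :: nat +
  fixes T :: "('f::field ^ 'x ^ 'x) ring"
  assumes char: "p = CHAR('f)" and T_eq: "T = terwilliger_algebra d R x"
begin

lemma of_nat_zero_iff: "(of_nat n :: 'f) = 0 \<longleftrightarrow> p dvd n"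
  by (simp add: char of_nat_eq_0_iff_char_dvd)

text \<open>The vector \<open>E\<^sub>i\<^sup>* \<one>\<close> over the field of \<open>T\<close>.\<close>

definition e :: "nat \<Rightarrow> 'f ^ 'x" where
  "e i = dual_vector R x i"

definition restr :: "nat set \<Rightarrow> 'f ^ 'x \<Rightarrow> 'f ^ 'x" where
  "restr D v = (\<chi> y. if cell y \<in> D then v $ y else 0)"

text \<open>The span of the \<open>E\<^sub>i\<^sup>* \<one>\<close> with \<open>i \<in> D\<close> (see \<open>span_e\<close>), described pointwise so that membership
can be tested by coordinates.\<close>

definition cellfun :: "nat set \<Rightarrow> ('f ^ 'x) set" where
  "cellfun D = {v. (\<forall>y. cell y \<notin> D \<longrightarrow> v $ y = 0) \<and> (\<forall>y z. cell y = cell z \<longrightarrow> v $ y = v $ z)}"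

lemma restr_nth [simp]: "restr D v $ y = (if cell y \<in> D then v $ y else 0)"
  by (simp add: restr_def)

lemma restr_add: "restr D (v + w) = restr D v + restr D w"
  by (simp add: vec_eq_iff)

lemma restr_all [simp]: "restr {..d} v = v"
  by (simp add: vec_eq_iff cell)

lemma cellfunI:
  assumes "\<And>y. cell y \<notin> D \<Longrightarrow> v $ y = 0" and "\<And>y z. cell y = cell z \<Longrightarrow> v $ y = v $ z"
  shows "v \<in> cellfun D"
  unfolding cellfun_def using assms by blast

lemma cellfun_zero: "v \<in> cellfun D \<Longrightarrow> cell y \<notin> D \<Longrightarrow> v $ y = 0"
  and cellfun_eq: "v \<in> cellfun D \<Longrightarrow> cell y = cell z \<Longrightarrow> v $ y = v $ z"
  unfolding cellfun_def by blast+

lemma restr_cellfun: "v \<in> cellfun D \<Longrightarrow> restr D v = v"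
  by (simp add: vec_eq_iff cellfun_zero)

lemma restr_cellfun_disjoint:
  assumes "v \<in> cellfun J" and "D \<inter> J = {}" shows "restr D v = 0"
proof -
  have "v $ y = 0" if "cell y \<in> D" for y
    using cellfun_zero[OF assms(1), of y] assms(2) that by blast
  then show ?thesis by (simp add: vec_eq_iff)
qed

lemma restr_in_cellfun:
  assumes "v \<in> cellfun I" shows "restr D v \<in> cellfun D"
proof (rule cellfunI)
  show "restr D v $ y = restr D v $ z" if "cell y = cell z" for y z
    using cellfun_eq[OF assms that] that by simp
qed simp

lemma restr_diff_cellfun:
  assumes "v \<in> cellfun I" shows "v - restr (I - J) v \<in> cellfun J"
proof (rule cellfunI)
  show "(v - restr (I - J) v) $ y = 0" if "cell y \<notin> J" for y
    using cellfun_zero[OF assms, of y] that by simp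
  show "(v - restr (I - J) v) $ y = (v - restr (I - J) v) $ z" if "cell y = cell z" for y z
    using cellfun_eq[OF assms that] that by simp
qed

lemma dual_idempotent_vector: "i \<le> d \<Longrightarrow> dual_idempotent R x i *v v = restr {i} v"
proof -
  assume i: "i \<le> d"
  have "(\<Sum>z\<in>UNIV. (if y = z \<and> (x, y) \<in> R i then 1 else 0) * v $ z) = (if cell y = i then v $ y else 0)" for y
    using i by (simp add: cell_iff if_distrib if_distribR cong: if_cong)
  then show ?thesis
    by (simp add: vec_eq_iff dual_idempotent_def matrix_vector_mult_def)
qed

lemma e_nth: "i \<le> d \<Longrightarrow> e i $ y = (if cell y = i then 1 else 0)"
  by (simp add: e_def dual_vector_def dual_idempotent_vector)

lemma e_cellfun:
  assumes "i \<le> d" shows "e i \<in> cellfun I \<longleftrightarrow> i \<in> I"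
proof
  obtain y where y: "cell y = i" using cell_surj assms by blast
  assume "e i \<in> cellfun I"
  then show "i \<in> I" using cellfun_zero[of "e i" I y] y assms by (auto simp: e_nth)
next
  assume "i \<in> I"
  then show "e i \<in> cellfun I" using assms by (auto intro!: cellfunI simp: e_nth)
qed

lemma cellfun_mono:
  assumes "I \<subseteq> J" shows "cellfun I \<subseteq> cellfun J"
  using assms unfolding cellfun_def by blast

lemma cellfun_mono_iff:
  assumes "I \<subseteq> {..d}" shows "cellfun I \<subseteq> cellfun J \<longleftrightarrow> I \<subseteq> J"
proof
  assume sub: "cellfun I \<subseteq> cellfun J"
  show "I \<subseteq> J"
  proof
    fix i assume "i \<in> I"
    then show "i \<in> J" using assms sub e_cellfun[of i] by auto
  qed
qed (rule cellfun_mono)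

lemma subspace_cellfun: "vec.subspace (cellfun D)"
proof (rule vec.subspaceI)
  show "0 \<in> cellfun D" by (rule cellfunI) simp_all
  fix v w assume v: "v \<in> cellfun D" and w: "w \<in> cellfun D"
  show "v + w \<in> cellfun D"
    using cellfun_zero[OF v] cellfun_zero[OF w] cellfun_eq[OF v] cellfun_eq[OF w]
    by (intro cellfunI) (metis add_0 vector_add_component)+
next
  fix c v assume v: "v \<in> cellfun D"
  show "c *s v \<in> cellfun D"
    using cellfun_zero[OF v] cellfun_eq[OF v]
    by (intro cellfunI) (metis mult_zero_right vector_smult_component)+
qed

lemma zero_cellfun [simp]: "0 \<in> cellfun D"
  by (rule vec.subspace_0[OF subspace_cellfun])

lemma cellfun_empty [simp]: "cellfun {} = {0}"
  using zero_cellfun by (auto simp: vec_eq_iff cellfun_zero)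

lemma span_e:
  assumes "I \<subseteq> {..d}" shows "vec.span (e ` I) = cellfun I"
proof
  show "vec.span (e ` I) \<subseteq> cellfun I"
    by (rule vec.span_minimal[OF _ subspace_cellfun]) (use assms e_cellfun in auto)
next
  have finI: "Finite_Set.finite I" using assms finite_subset by blast
  show "cellfun I \<subseteq> vec.span (e ` I)"
  proof
    fix v assume v: "v \<in> cellfun I"
    define rep where "rep i = (SOME y. cell y = i)" for i
    have rep: "cell (rep (cell y)) = cell y" for y
      unfolding rep_def by (rule someI[of _ y]) simp
    have "v = (\<Sum>i\<in>I. (v $ rep i) *s e i)"
    proof (subst vec_eq_iff, rule allI)
      fix y
      have "(\<Sum>i\<in>I. (v $ rep i) *s e i) $ y = (\<Sum>i\<in>I. if cell y = i then v $ rep i else 0)"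
        unfolding sum_component by (rule sum.cong) (use assms in \<open>auto simp: e_nth\<close>)
      also have "\<dots> = (if cell y \<in> I then v $ rep (cell y) else 0)"
        using finI by simp
      also have "\<dots> = v $ y"
        using cellfun_zero[OF v, of y] cellfun_eq[OF v rep[of y]] by simp
      finally show "v $ y = (\<Sum>i\<in>I. (v $ rep i) *s e i) $ y" by simp
    qed
    moreover have "(\<Sum>i\<in>I. (v $ rep i) *s e i) \<in> vec.span (e ` I)"
      by (intro vec.span_sum vec.span_scale vec.span_base) auto
    ultimately show "v \<in> vec.span (e ` I)" by simp
  qed
qed

lemma restr_single:
  assumes v: "v \<in> cellfun D" shows "restr {cell y} v = (v $ y) *s e (cell y)"
proof -
  have "restr {cell y} v $ z = ((v $ y) *s e (cell y)) $ z" for z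
    using cellfun_eq[OF v, of z y] by (simp add: e_nth cell)
  then show ?thesis by (simp add: vec_eq_iff)
qed

text \<open>The structure constants of the action on \<open>W\<^sub>0\<close>: the coordinate at \<open>y\<close> counts the \<open>z\<close> with
\<open>(y, z) \<in> R\<^sub>j\<close> in the cell of index \<open>i\<close>, which is an intersection number after reversing \<open>R\<^sub>j\<close>.\<close>

lemma adjacency_vector:
  assumes "i \<le> d" "j \<le> d"
  shows "(adjacency_matrix R j *v e i) $ y = of_nat (inum i (conv j) (cell y))"
proof -
  have "(adjacency_matrix R j *v e i) $ y = (\<Sum>z\<in>UNIV. if (y, z) \<in> R j \<and> cell z = i then 1 else 0)"
    unfolding matrix_vector_mult_def adjacency_matrix_def
    by (simp add: e_nth assms) (rule sum.cong, auto)
  also have "\<dots> = of_nat (card {z. (y, z) \<in> R j \<and> cell z = i})"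
    by (simp flip: sum.inter_filter)
  also have "{z. (y, z) \<in> R j \<and> cell z = i} = {z. (x, z) \<in> R i \<and> (z, y) \<in> R (conv j)}"
    using assms by (auto simp: cell_iff converse_index)
  also have "card \<dots> = inum i (conv j) (cell y)"
    using assms converse_index(1)[of j] cell[of y] by (simp add: intersection_number[of _ _ _ x y])
  finally show ?thesis .
qed

lemma carrier_T: "carrier T = unital_subalgebra hull (adjacency_matrix R ` {..d} \<union> dual_idempotent R x ` {..d})"
  by (simp add: T_eq terwilliger_algebra_def matrix_ring_def)

lemma T_ops [simp]:
  "monoid.mult T = (**)" "one T = mat 1" "zero T = 0" "add T = (+)"
  by (simp_all add: T_eq terwilliger_algebra_def matrix_ring_def)

lemma subalgebra_T: "unital_subalgebra (carrier T)"
  unfolding carrier_T by (rule unital_subalgebra_hull)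

lemma ring_T: "ring T"
  unfolding T_eq terwilliger_algebra_def by (rule ring_matrix_ring[OF unital_subalgebra_hull])

lemma adjacency_in_T: "j \<le> d \<Longrightarrow> adjacency_matrix R j \<in> carrier T"
  and dual_idempotent_in_T: "j \<le> d \<Longrightarrow> dual_idempotent R x j \<in> carrier T"
  unfolding carrier_T by (auto intro: hull_inc)

lemma mult_in_T: "a \<in> carrier T \<Longrightarrow> b \<in> carrier T \<Longrightarrow> a ** b \<in> carrier T"
  using subalgebra_T unfolding unital_subalgebra_def by blast

lemma mat_in_T: "mat c \<in> carrier T"
proof -
  have "map_matrix (\<lambda>b. c * b) (mat 1) \<in> carrier T"
    using subalgebra_T unfolding unital_subalgebra_def by blast
  also have "map_matrix (\<lambda>b. c * b) (mat 1) = (mat c :: 'f ^ 'x ^ 'x)"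
    by (simp add: vec_eq_iff mat_def map_matrix_def)
  finally show ?thesis .
qed

text \<open>The matrices that preserve a given subspace form a unital subalgebra, so the generators suffice.
For \<open>A\<^sub>j\<close> closedness of \<open>I\<close> says that the structure constants leading out of \<open>I\<close> vanish.\<close>

lemma T_preserves_cellfun:
  assumes a: "a \<in> carrier T" and I: "forward_closed I" and "v \<in> cellfun I"
  shows "a *v v \<in> cellfun I"
proof -
  have "\<forall>v\<in>cellfun I. a *v v \<in> cellfun I"
    using a unfolding carrier_T
  proof (rule hull_induct)
    fix a :: "'f ^ 'x ^ 'x"
    assume a: "a \<in> adjacency_matrix R ` {..d} \<union> dual_idempotent R x ` {..d}"
    have restr_in_I: "restr D v \<in> cellfun I" if v: "v \<in> cellfun I" for v D
    proof (rule cellfunI)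
      show "restr D v $ y = restr D v $ z" if "cell y = cell z" for y z
        using cellfun_eq[OF v that] that by simp
    qed (use cellfun_zero[OF v] in simp)
    from a show "\<forall>v\<in>cellfun I. a *v v \<in> cellfun I"
    proof
      assume "a \<in> dual_idempotent R x ` {..d}"
      then obtain i where "i \<le> d" "a = dual_idempotent R x i" by auto
      then show ?thesis
        using restr_in_I by (simp add: dual_idempotent_vector)
    next
      assume "a \<in> adjacency_matrix R ` {..d}"
      then obtain j where j: "j \<le> d" "a = adjacency_matrix R j" by auto
      have gen: "a *v e i \<in> cellfun I" if i: "i \<in> I" for i
      proof -
        have "i \<le> d" using i forward_closed_subset[OF I] by auto
        moreover have "p dvd inum i (conv j) (cell y)" if "cell y \<notin> I" for y
          using I i that j(1) cell(1)[of y] \<open>i \<le> d\<close> by (auto simp: forward_closed_def arc_def)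
        ultimately show ?thesis
          using j by (intro cellfunI) (simp_all add: adjacency_vector of_nat_zero_iff)
      qed
      show ?thesis
      proof
        fix v assume "v \<in> cellfun I"
        then have "v \<in> vec.span (e ` I)"
          using span_e[OF forward_closed_subset[OF I]] by simp
        then show "a *v v \<in> cellfun I"
        proof (rule vec.span_induct)
          show "vec.subspace {v. a *v v \<in> cellfun I}"
            using vec.subspace_0[OF subspace_cellfun] vec.subspace_add[OF subspace_cellfun]
              vec.subspace_scale[OF subspace_cellfun]
            by (auto simp: vec.subspace_def vec.add vec.scale)
        qed (use gen in auto)
      qed
    qed
  next
    show "unital_subalgebra {a. \<forall>v\<in>cellfun I. a *v v \<in> cellfun I}"
      unfolding unital_subalgebra_def
      using vec.subspace_add[OF subspace_cellfun] vec.subspace_scale[OF subspace_cellfun]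
      by (auto simp: matrix_vector_mult_add_rdistrib map_matrix_scale_vector simp flip: matrix_vector_mul_assoc)
  qed
  then show ?thesis using assms(3) by blast
qed

section \<open>Layers\<close>

text \<open>A model of \<open>cellfun I / cellfun J\<close> for \<open>D = I - J\<close>: every coset has exactly one representative
supported on the cells of \<open>D\<close>, and truncation finds it after each action of \<open>T\<close>.\<close>

definition layer :: "nat set \<Rightarrow> ('f ^ 'x ^ 'x, 'f ^ 'x) module" where
  "layer D = \<lparr>carrier = cellfun D, monoid.mult = undefined, one = undefined, zero = 0, add = (+),
     smult = (\<lambda>a v. restr D (a *v v))\<rparr>"

lemma layer_simps [simp]:
  "carrier (layer D) = cellfun D" "zero (layer D) = 0" "add (layer D) = (+)"
  "smult (layer D) = (\<lambda>a v. restr D (a *v v))"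
  by (simp_all add: layer_def)

lemma cellfun_add: "v \<in> cellfun D \<Longrightarrow> w \<in> cellfun D \<Longrightarrow> v + w \<in> cellfun D"
  by (rule vec.subspace_add[OF subspace_cellfun])

lemma cellfun_scale: "v \<in> cellfun D \<Longrightarrow> c *s v \<in> cellfun D"
  by (rule vec.subspace_scale[OF subspace_cellfun])

lemma restr_diff_in_cellfun:
  assumes w: "w \<in> cellfun (J \<union> K)" shows "restr (I - J) w \<in> cellfun K"
proof (rule cellfunI)
  show "restr (I - J) w $ y = 0" if "cell y \<notin> K" for y
    using cellfun_zero[OF w, of y] that by auto
  show "restr (I - J) w $ y = restr (I - J) w $ z" if "cell y = cell z" for y z
    using cellfun_eq[OF w that] that by simp
qed

text \<open>The part cut off by truncation lies in \<open>cellfun J\<close>, stays there under \<open>T\<close>, and is invisible on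
\<open>I - J\<close>. This is the associativity of the action on a layer.\<close>

lemma restr_act_restr:
  assumes I: "forward_closed I" and J: "forward_closed J" and a: "a \<in> carrier T" and v: "v \<in> cellfun I"
  shows "restr (I - J) (a *v restr (I - J) v) = restr (I - J) (a *v v)"
proof -
  let ?w = "v - restr (I - J) v"
  have "a *v ?w \<in> cellfun J"
    using T_preserves_cellfun[OF a J restr_diff_cellfun[OF v]] .
  then have "restr (I - J) (a *v ?w) = 0"
    by (rule restr_cellfun_disjoint) auto
  moreover have "a *v v = a *v ?w + a *v restr (I - J) v"
    by (simp flip: matrix_vector_right_distrib)
  ultimately show ?thesis by (simp add: restr_add)
qed

lemma left_module_layer:
  assumes I: "forward_closed I" and J: "forward_closed J"
  shows "left_module T (layer (I - J))"
proof (intro left_module.intro left_module_axioms.intro ring_T)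
  have sub: "cellfun (I - J) \<subseteq> cellfun I" by (rule cellfun_mono) auto
  show "abelian_group (layer (I - J))"
  proof (rule abelian_groupI)
    fix v assume "v \<in> carrier (layer (I - J))"
    then show "\<exists>w\<in>carrier (layer (I - J)). w \<oplus>\<^bsub>layer (I - J)\<^esub> v = \<zero>\<^bsub>layer (I - J)\<^esub>"
      using vec.subspace_neg[OF subspace_cellfun] by (intro bexI[of _ "- v"]) auto
  qed (auto simp: cellfun_add algebra_simps)
  fix a v assume a: "a \<in> carrier T" and v: "v \<in> carrier (layer (I - J))"
  have vI: "v \<in> cellfun I" using v sub by auto
  note av = T_preserves_cellfun[OF a I vI]
  show "a \<odot>\<^bsub>layer (I - J)\<^esub> v \<in> carrier (layer (I - J))"
    using restr_in_cellfun[OF av] by simp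
  fix b assume b: "b \<in> carrier T"
  note bv = T_preserves_cellfun[OF b I vI]
  show "(a \<oplus>\<^bsub>T\<^esub> b) \<odot>\<^bsub>layer (I - J)\<^esub> v = a \<odot>\<^bsub>layer (I - J)\<^esub> v \<oplus>\<^bsub>layer (I - J)\<^esub> b \<odot>\<^bsub>layer (I - J)\<^esub> v"
    by (simp add: matrix_vector_mult_add_rdistrib restr_add)
  show "(a \<otimes>\<^bsub>T\<^esub> b) \<odot>\<^bsub>layer (I - J)\<^esub> v = a \<odot>\<^bsub>layer (I - J)\<^esub> (b \<odot>\<^bsub>layer (I - J)\<^esub> v)"
    using restr_act_restr[OF I J a bv] by (simp add: matrix_vector_mul_assoc)
next
  fix v assume "v \<in> carrier (layer (I - J))"
  then show "\<one>\<^bsub>T\<^esub> \<odot>\<^bsub>layer (I - J)\<^esub> v = v"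
    by (simp add: restr_cellfun)
qed (auto simp: matrix_vector_right_distrib restr_add)

lemma submodule_layerI:
  assumes I: "forward_closed I" and J: "forward_closed J"
    and K: "K \<subseteq> I - J" "forward_closed (J \<union> K)"
  shows "submodule (cellfun K) T (layer (I - J))"
proof (rule left_module.submoduleI[OF left_module_layer[OF I J]])
  fix a v assume a: "a \<in> carrier T" and v: "v \<in> cellfun K"
  have "v \<in> cellfun (J \<union> K)" using v cellfun_mono[of K "J \<union> K"] by auto
  then show "a \<odot>\<^bsub>layer (I - J)\<^esub> v \<in> cellfun K"
    using restr_diff_in_cellfun[OF T_preserves_cellfun[OF a K(2)]] by simp
qed (use cellfun_mono[OF K(1)] cellfun_add in auto)

text \<open>The set \<open>K\<close> collects the \<open>i \<in> I - J\<close> with \<open>e i \<in> H\<close>. Applying \<open>E\<^sub>i\<^sup>*\<close> to an element of \<open>H\<close> isolates its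
component along \<open>e i\<close>, so \<open>H\<close> is spanned by these vectors; and if \<open>e i \<in> H\<close>, then an arc from
\<open>i\<close> to \<open>l\<close> with \<open>l \<in> I - J\<close> puts \<open>e l\<close> into \<open>H\<close>.\<close>

lemma submodule_layerE:
  assumes I: "forward_closed I" and J: "forward_closed J" and JI: "J \<subseteq> I"
    and H: "submodule H T (layer (I - J))"
  obtains K where "K \<subseteq> I - J" "forward_closed (J \<union> K)" "H = cellfun K"
proof
  let ?D = "I - J"
  define K where "K = {i \<in> ?D. e i \<in> H}"
  have Id: "I \<subseteq> {..d}" using I by (rule forward_closed_subset)
  have HD: "H \<subseteq> cellfun ?D" and H0: "0 \<in> H"
    and Hadd: "\<And>v w. v \<in> H \<Longrightarrow> w \<in> H \<Longrightarrow> v + w \<in> H"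
    and Hact: "\<And>a v. a \<in> carrier T \<Longrightarrow> v \<in> H \<Longrightarrow> restr ?D (a *v v) \<in> H"
    using submoduleD[OF H] by auto
  have Hscale: "c *s v \<in> H" if v: "v \<in> H" for c v
    using Hact[OF mat_in_T[of c] v] restr_cellfun[OF cellfun_scale, of v ?D c] HD v
    by (auto simp: mat_vector)
  have unscale: "v \<in> H" if "c *s v \<in> H" "c \<noteq> 0" for c v
    using Hscale[OF that(1), of "inverse c"] that(2) by (simp add: vector_smult_assoc)
  have coord: "e (cell y) \<in> H" if v: "v \<in> H" and nz: "v $ y \<noteq> 0" for v y
  proof -
    have vD: "v \<in> cellfun ?D" using v HD by auto
    then have y: "cell y \<in> ?D" using nz cellfun_zero by blast
    have "restr ?D (restr {cell y} v) \<in> H"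
      using Hact[OF dual_idempotent_in_T v, of "cell y"] by (simp add: dual_idempotent_vector cell)
    moreover have "restr ?D (restr {cell y} v) = (v $ y) *s e (cell y)"
      unfolding restr_single[OF vD]
      using y by (intro restr_cellfun cellfun_scale) (simp add: e_cellfun cell)
    ultimately show ?thesis using unscale nz by metis
  qed
  show KD: "K \<subseteq> ?D" by (auto simp: K_def)
  show "H = cellfun K"
  proof
    show "H \<subseteq> cellfun K"
    proof
      fix v assume v: "v \<in> H"
      then have vD: "v \<in> cellfun ?D" using HD by auto
      show "v \<in> cellfun K"
      proof (rule cellfunI)
        show "v $ y = 0" if "cell y \<notin> K" for y
          using coord[OF v, of y] cellfun_zero[OF vD, of y] that by (auto simp: K_def)
      qed (rule cellfun_eq[OF vD])
    qed
    have "vec.span (e ` K) \<subseteq> H"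
      by (rule vec.span_minimal) (use H0 Hadd Hscale in \<open>auto simp: K_def vec.subspace_def\<close>)
    then show "cellfun K \<subseteq> H"
      using span_e[of K] KD Id by auto
  qed
  show "forward_closed (J \<union> K)"
    unfolding forward_closed_def
  proof (intro conjI ballI allI impI)
    show "J \<union> K \<subseteq> {..d}" using KD JI Id by auto
    fix i l assume i: "i \<in> J \<union> K" and arc: "arc i l"
    show "l \<in> J \<union> K"
    proof (cases "i \<in> J \<or> l \<in> J")
      case True
      then show ?thesis using J arc by (auto simp: forward_closed_def)
    next
      case False
      then have eH: "e i \<in> H" and iI: "i \<in> I" using i by (auto simp: K_def)
      have lD: "l \<in> ?D" using False I iI arc by (auto simp: forward_closed_def)
      obtain j where j: "i \<le> d" "l \<le> d" "j \<le> d" and ndvd: "\<not> p dvd inum i (conv j) l"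
        using arc by (auto simp: arc_def)
      obtain y where y: "cell y = l" using cell_surj[OF j(2)] by blast
      let ?u = "adjacency_matrix R j *v e i" and ?c = "of_nat (inum i (conv j) l) :: 'f"
      have uI: "?u \<in> cellfun I"
        using T_preserves_cellfun[OF adjacency_in_T I, of j "e i"] j iI by (simp add: e_cellfun)
      have "restr {l} ?u = ?c *s e l"
        using restr_single[OF uI, of y] y j by (simp add: adjacency_vector)
      moreover have "restr ?D (restr {l} ?u) \<in> H"
        using Hact[OF mult_in_T[OF dual_idempotent_in_T adjacency_in_T] eH, of l j] j
        by (simp add: dual_idempotent_vector flip: matrix_vector_mul_assoc)
      moreover have "restr ?D (?c *s e l) = ?c *s e l"
        using lD j by (intro restr_cellfun cellfun_scale) (simp add: e_cellfun)
      ultimately have "e l \<in> H"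
        using unscale[of ?c "e l"] ndvd by (simp add: of_nat_zero_iff)
      then show ?thesis using lD by (simp add: K_def)
    qed
  qed
qed

lemma cellfun_inj: "I \<subseteq> {..d} \<Longrightarrow> J \<subseteq> {..d} \<Longrightarrow> cellfun I = cellfun J \<Longrightarrow> I = J"
  using cellfun_mono_iff by blast

text \<open>Submodules of the layer correspond to closed sets between \<open>J\<close> and \<open>I\<close>, and there is none
strictly between them exactly when \<open>I - J\<close> is a component or empty; the zero module is
excluded by the definition of irreducibility.\<close>

lemma irreducible_layer_iff:
  assumes I: "forward_closed I" and J: "forward_closed J" and JI: "J \<subseteq> I"
  shows "irreducible_module T (layer (I - J)) \<longleftrightarrow> I - J \<in> components"
proof
  have D: "I - J \<subseteq> {..d}" using forward_closed_subset[OF I] by auto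
  {
    assume irr: "irreducible_module T (layer (I - J))"
    then have "cellfun (I - J) \<noteq> {0}" by (simp add: irreducible_module_def)
    then have "I - J \<noteq> {}" using cellfun_empty by metis
    show "I - J \<in> components"
    proof (rule component_step[OF I J])
      show "J \<subset> I" using JI \<open>I - J \<noteq> {}\<close> by auto
      fix K assume K: "forward_closed K" "J \<subset> K" "K \<subseteq> I"
      have "J \<union> (K - J) = K" using K by auto
      then have "submodule (cellfun (K - J)) T (layer (I - J))"
        using K by (intro submodule_layerI[OF I J]) auto
      then have "cellfun (K - J) = cellfun {} \<or> cellfun (K - J) = cellfun (I - J)"
        using irr by (auto simp: irreducible_module_def)
      then have "K - J = {} \<or> K - J = I - J"
        using cellfun_inj[of "K - J" "{}"] cellfun_inj[of "K - J" "I - J"] D K(3) by blast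
      then show "K = I" using K JI by blast
    qed
  }
  {
    assume comp: "I - J \<in> components"
    have "cellfun (I - J) \<noteq> cellfun {}"
      using cellfun_inj[OF D, of "{}"] component_nonempty[OF comp] by auto
    moreover have "H = {0} \<or> H = cellfun (I - J)" if H: "submodule H T (layer (I - J))" for H
    proof -
      obtain K where K: "K \<subseteq> I - J" "forward_closed (J \<union> K)" "H = cellfun K"
        using submodule_layerE[OF I J JI H] by blast
      have "J \<union> K = J \<or> J \<union> K = I"
        using no_closed_between[OF comp K(2)] K(1) JI by blast
      then have "K = {} \<or> K = I - J" using K(1) by blast
      then show ?thesis using K(3) by auto
    qed
    ultimately show "irreducible_module T (layer (I - J))"
      using left_module_layer[OF I J] by (simp add: irreducible_module_def)
  }
qed

text \<open>For \<open>i \<in> C\<close> the idempotent \<open>E\<^sub>i\<^sup>*\<close> fixes the nonzero vector \<open>e i\<close> of the layer of \<open>C\<close>, whereas it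
annihilates the layer of \<open>D\<close> unless \<open>i \<in> D\<close>.\<close>

lemma layer_isomorphic_imp_subset:
  assumes C: "left_module T (layer C)" and D: "left_module T (layer D)" and "C \<subseteq> {..d}"
    and iso: "module_isomorphic T (layer C) (layer D)"
  shows "C \<subseteq> D"
proof
  fix i assume i: "i \<in> C"
  then have id: "i \<le> d" using assms(3) by auto
  obtain f where f: "f \<in> iso (add_monoid (layer C)) (add_monoid (layer D))"
    and act: "\<And>a v. a \<in> carrier T \<Longrightarrow> v \<in> cellfun C \<Longrightarrow> f (restr C (a *v v)) = restr D (a *v f v)"
    using iso unfolding module_isomorphic_def by auto
  have ei: "e i \<in> cellfun C" using i id by (simp add: e_cellfun)
  have f0: "f 0 = 0" using iso_zero[OF C D f] by simp
  have inj: "inj_on f (cellfun C)" using isoE_bij(1)[OF f] by (simp add: bij_betw_def)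
  obtain y where y: "cell y = i" using cell_surj[OF id] by blast
  show "i \<in> D"
  proof (rule ccontr)
    assume "i \<notin> D"
    then have "restr D (restr {i} w) = 0" for w
      by (auto simp: vec_eq_iff)
    moreover have "restr C (restr {i} (e i)) = e i"
      using i id by (auto simp: vec_eq_iff e_nth)
    ultimately have "f (e i) = 0"
      using act[OF dual_idempotent_in_T[OF id] ei] by (simp add: dual_idempotent_vector id)
    then have "e i = 0" using inj_onD[OF inj, of "e i" 0] f0 ei by simp
    then have "e i $ y = 0" by simp
    then show False using y id by (simp add: e_nth)
  qed
qed

text \<open>The inverse sends a coset to the truncation of any of its members to the cells of \<open>I - J\<close>.\<close>

lemma quotient_iso:
  assumes I: "forward_closed I" and J: "forward_closed J" and JI: "J \<subseteq> I"
  shows "coset (cellfun J) \<in> iso (add_monoid (layer (I - J)))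
           (add_monoid (quotient_module (column_module (cellfun I)) (cellfun J)))"
    and "a \<in> carrier T \<Longrightarrow> v \<in> cellfun (I - J) \<Longrightarrow> coset (cellfun J) (restr (I - J) (a *v v)) =
           a \<odot>\<^bsub>quotient_module (column_module (cellfun I)) (cellfun J)\<^esub> coset (cellfun J) v"
proof -
  let ?N = "cellfun J" and ?D = "I - J"
  have sub: "cellfun ?D \<subseteq> cellfun I" by (rule cellfun_mono) auto
  have project: "coset ?N (restr ?D v) = coset ?N v" if "v \<in> cellfun I" for v
    using restr_diff_cellfun[OF that, of J] coset_eq[OF subspace_cellfun, of J v "restr ?D v"] by simp
  have "coset ?N ` cellfun ?D = coset ?N ` cellfun I"
  proof
    show "coset ?N ` cellfun I \<subseteq> coset ?N ` cellfun ?D"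
      using project restr_in_cellfun by (metis image_eqI image_subsetI)
  qed (use sub in auto)
  moreover have "inj_on (coset ?N) (cellfun ?D)"
  proof (rule inj_onI)
    fix v w assume v: "v \<in> cellfun ?D" and w: "w \<in> cellfun ?D" and "coset ?N v = coset ?N w"
    then have "v - w \<in> cellfun J" by (simp add: coset_eq[OF subspace_cellfun])
    then have "restr ?D (v - w) = 0" by (rule restr_cellfun_disjoint) auto
    moreover have "restr ?D (v - w) = v - w"
      using v w by (intro restr_cellfun vec.subspace_diff[OF subspace_cellfun])
    ultimately show "v = w" by simp
  qed
  ultimately show "coset ?N \<in> iso (add_monoid (layer ?D))
      (add_monoid (quotient_module (column_module (cellfun I)) ?N))"
    using sub by (auto simp: iso_def hom_def bij_betw_def quotient_column_module
        set_add_coset[OF subspace_cellfun])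
  assume a: "a \<in> carrier T" and v: "v \<in> cellfun ?D"
  have "a *v v \<in> cellfun I" using T_preserves_cellfun[OF a I] v sub by auto
  then show "coset ?N (restr ?D (a *v v)) = a \<odot>\<^bsub>quotient_module (column_module (cellfun I)) ?N\<^esub> coset ?N v"
    using smult_coset[of ?N a v, OF subspace_cellfun] T_preserves_cellfun[OF a J]
    by (simp add: project quotient_column_module)
qed

lemma quotient_isomorphic_layer:
  assumes "forward_closed I" and "forward_closed J" and "J \<subseteq> I"
  shows "module_isomorphic T (layer (I - J)) (quotient_module (column_module (cellfun I)) (cellfun J))"
  unfolding module_isomorphic_def
  by (rule bexI[OF _ quotient_iso(1)[OF assms]]) (simp add: quotient_iso(2)[OF assms])

lemma left_module_quotient:
  assumes "forward_closed I" and "forward_closed J" and "J \<subseteq> I"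
  shows "left_module T (quotient_module (column_module (cellfun I)) (cellfun J))"
  by (rule left_module_transfer[OF left_module_layer quotient_iso(1)[OF assms]])
    (use assms quotient_iso(2)[OF assms] in
      \<open>simp_all add: quotient_column_module coset_zero subspace_cellfun\<close>)

lemma irreducible_quotient_iff:
  assumes "forward_closed I" and "forward_closed J" and "J \<subseteq> I"
  shows "irreducible_module T (quotient_module (column_module (cellfun I)) (cellfun J)) \<longleftrightarrow>
    I - J \<in> components"
proof -
  note L = left_module_layer[OF assms(1,2)] and M = left_module_quotient[OF assms]
    and iso = quotient_isomorphic_layer[OF assms]
  show ?thesis
    using irreducible_module_transfer[OF L M iso]
      irreducible_module_transfer[OF M L module_isomorphic_sym[OF L iso]]
      irreducible_layer_iff[OF assms] by blast
qed

section \<open>Composition series of the primary module\<close>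

lemma primary_module_eq: "primary_module d R x = column_module (cellfun {..d})"
  using span_e[of "{..d}"] by (simp add: primary_module_def e_def image_def)

text \<open>The primary module is the layer of the set of all indices, over the empty set: truncation to all
cells does nothing.\<close>

lemma submodule_primary_iff:
  "submodule H T (column_module (cellfun {..d})) \<longleftrightarrow> (\<exists>I. forward_closed I \<and> H = cellfun I)"
proof -
  have "submodule H T (column_module (cellfun {..d})) \<longleftrightarrow> submodule H T (layer ({..d} - {}))"
    by (simp add: submodule_def submodule_axioms_def subgroup_def m_inv_def)
  also have "\<dots> \<longleftrightarrow> (\<exists>I. forward_closed I \<and> H = cellfun I)"
  proof
    assume "submodule H T (layer ({..d} - {}))"
    from submodule_layerE[OF forward_closed_vertices forward_closed_empty empty_subsetI this]
    show "\<exists>I. forward_closed I \<and> H = cellfun I" by auto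
  next
    assume "\<exists>I. forward_closed I \<and> H = cellfun I"
    then obtain I where "forward_closed I" "H = cellfun I" by blast
    then show "submodule H T (layer ({..d} - {}))"
      using submodule_layerI[OF forward_closed_vertices forward_closed_empty, of I] forward_closed_subset
      by auto
  qed
  finally show ?thesis .
qed

lemma series_factor_primary:
  fixes H :: "nat \<Rightarrow> ('f ^ 'x) set"
  shows "series_factor (primary_module d R x) H k = quotient_module (column_module (H (Suc k))) (H k)"
  by (simp add: series_factor_def primary_module_eq column_module_def)

text \<open>Submodules are given by closed sets and irreducible factors by components, so the two notions
of a maximal chain agree.\<close>

lemma composition_series_iff:
  "composition_series T (primary_module d R x) H n \<longleftrightarrow>
     (\<exists>S. closed_chain S n \<and> S n = {..d} \<and> (\<forall>k\<le>n. H k = cellfun (S k)))"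
proof
  assume cs: "composition_series T (primary_module d R x) H n"
  then have "\<forall>k\<le>n. \<exists>I. forward_closed I \<and> H k = cellfun I"
    by (simp add: composition_series_def primary_module_eq submodule_primary_iff)
  then obtain S where S: "\<And>k. k \<le> n \<Longrightarrow> forward_closed (S k) \<and> H k = cellfun (S k)"
    by metis
  have Sd: "S k \<subseteq> {..d}" if "k \<le> n" for k using S[OF that] forward_closed_subset by auto
  have "cellfun (S 0) = cellfun {}" "cellfun (S n) = cellfun {..d}"
    using cs S[of 0] S[of n] by (simp_all add: composition_series_def primary_module_eq)
  then have ends: "S 0 = {}" "S n = {..d}"
    using cellfun_inj Sd[of 0] Sd[of n] by blast+
  have "S k \<subset> S (Suc k) \<and> S (Suc k) - S k \<in> components" if k: "k < n" for k
  proof -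
    have fc: "forward_closed (S k)" "forward_closed (S (Suc k))"
      and H: "H k = cellfun (S k)" "H (Suc k) = cellfun (S (Suc k))"
      using S[of k] S[of "Suc k"] k by auto
    have "H k \<subset> H (Suc k)" and irr: "irreducible_module T (series_factor (primary_module d R x) H k)"
      using cs k by (auto simp: composition_series_def)
    then have sub: "S k \<subset> S (Suc k)"
      using cellfun_mono_iff Sd[of k] k unfolding H by auto
    then show ?thesis
      using irr irreducible_quotient_iff[OF fc(2,1)] unfolding series_factor_primary H by auto
  qed
  then have "closed_chain S n" using ends S by (simp add: closed_chain_def)
  then show "\<exists>S. closed_chain S n \<and> S n = {..d} \<and> (\<forall>k\<le>n. H k = cellfun (S k))"
    using ends S by blast
next
  assume "\<exists>S. closed_chain S n \<and> S n = {..d} \<and> (\<forall>k\<le>n. H k = cellfun (S k))"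
  then obtain S where S: "closed_chain S n" "S n = {..d}" and H: "\<And>k. k \<le> n \<Longrightarrow> H k = cellfun (S k)"
    by blast
  have fc: "forward_closed (S k)" if "k \<le> n" for k using S that by (simp add: closed_chain_def)
  have step: "S k \<subset> S (Suc k)" "S (Suc k) - S k \<in> components" if "k < n" for k
    using S that by (auto simp: closed_chain_def)
  have "H k \<subset> H (Suc k) \<and> irreducible_module T (series_factor (primary_module d R x) H k)" if k: "k < n" for k
  proof
    have "\<not> cellfun (S (Suc k)) \<subseteq> cellfun (S k)"
      using step(1)[OF k] cellfun_mono_iff[OF forward_closed_subset[OF fc[of "Suc k"]]] k by auto
    then show "H k \<subset> H (Suc k)"
      using step(1)[OF k] cellfun_mono[of "S k" "S (Suc k)"] H k by auto
    show "irreducible_module T (series_factor (primary_module d R x) H k)"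
      using irreducible_quotient_iff[of "S (Suc k)" "S k"] step[OF k] fc k H
      by (simp add: series_factor_primary)
  qed
  moreover have "submodule (H k) T (primary_module d R x)" if "k \<le> n" for k
    using fc[OF that] H[OF that] by (auto simp: primary_module_eq submodule_primary_iff)
  moreover have "H 0 = {0}" "H n = cellfun {..d}"
    using H[of 0] H[of n] S by (simp_all add: closed_chain_def)
  ultimately show "composition_series T (primary_module d R x) H n"
    by (simp add: composition_series_def primary_module_eq)
qed

lemma composition_series_factors:
  assumes cs: "composition_series T (primary_module d R x) H n"
  obtains c where "bij_betw c {..<n} components"
    and "\<And>k. k < n \<Longrightarrow> module_isomorphic T (layer (c k)) (series_factor (primary_module d R x) H k)"
proof -
  obtain S where S: "closed_chain S n" "S n = {..d}" "\<forall>k\<le>n. H k = cellfun (S k)"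
    using cs unfolding composition_series_iff by blast
  show ?thesis
  proof
    show "bij_betw (\<lambda>k. S (Suc k) - S k) {..<n} components"
      by (rule closed_chain_bij[OF S(1,2)])
    fix k assume k: "k < n"
    have "forward_closed (S (Suc k))" "forward_closed (S k)" "S k \<subseteq> S (Suc k)"
      using S(1) k by (auto simp: closed_chain_def)
    from quotient_isomorphic_layer[OF this]
    show "module_isomorphic T (layer (S (Suc k) - S k)) (series_factor (primary_module d R x) H k)"
      using S(3) k by (simp add: series_factor_primary)
  qed
qed

lemma composition_series_exists: "\<exists>H n. composition_series T (primary_module d R x) H n"
proof -
  obtain S n where "closed_chain S n" "S n = {..d}"
    using closed_chain_exists[OF forward_closed_vertices] by blast
  then have "composition_series T (primary_module d R x) (\<lambda>k. cellfun (S k)) n"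
    unfolding composition_series_iff by blast
  then show ?thesis by blast
qed

section \<open>The modules of the equivalence classes\<close>

lemma W_space_eq: "W_space p d R x n = cellfun (divisible n)"
  using span_e[OF forward_closed_subset[OF forward_closed_divisible], of n]
  by (simp add: W_space_def e_def image_def divisible_def)

text \<open>The span in \<open>W\<^sub>q / W\<^bsub>q+1\<^esub>\<close> consists of the cosets of vectors in the span of the \<open>e i\<close> with \<open>i \<in> C\<close>
or \<open>e i \<in> W\<^bsub>q+1\<^esub>\<close>. A coset as a set does not remember the space it was formed in, so the two
records are equal, not merely isomorphic.\<close>

lemma Irr_eq:
  assumes C: "C \<in> Q_classes p d R q"
  shows "Irr p d R x q C =
    quotient_module (column_module (cellfun (C \<union> divisible (Suc q)))) (cellfun (divisible (Suc q)))"
proof -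
  let ?I = "C \<union> divisible (Suc q)" and ?J = "divisible (Suc q)"
  let ?g = "coset (cellfun ?J)" and ?V = "quotient_module (column_module (cellfun (divisible q))) (cellfun ?J)"
  have I: "forward_closed ?I" by (rule forward_closed_Q_class[OF C])
  have J: "forward_closed ?J" by (rule forward_closed_divisible)
  have IW: "?I \<subseteq> divisible q"
    using Q_class(2)[OF C] divisible_Suc by (auto simp: S_set_eq)
  have Id: "?I \<subseteq> {..d}" using I by (rule forward_closed_subset)
  have V: "left_module T ?V"
    by (rule left_module_quotient[OF forward_closed_divisible J divisible_Suc])
  have gens: "(\<lambda>i. cellfun ?J +>\<^bsub>column_module (cellfun (divisible q))\<^esub> dual_vector R x i) ` C = ?g ` e ` C"
    by (simp add: a_r_coset_column_module e_def image_image)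
  have smult: "a \<odot>\<^bsub>?V\<^esub> ?g v = ?g (a *v v)" if "a \<in> carrier T" for a v
    using smult_coset[of "cellfun ?J" a v, OF subspace_cellfun] T_preserves_cellfun[OF that J]
    by (simp add: quotient_column_module)
  have scale: "mat c \<odot>\<^bsub>?V\<^esub> ?g v = ?g (c *s v)" for c v
    using smult[OF mat_in_T] by (simp add: mat_vector)
  have add: "?g v \<oplus>\<^bsub>?V\<^esub> ?g w = ?g (v + w)" for v w
    by (simp add: quotient_column_module set_add_coset[OF subspace_cellfun])
  have zero: "\<zero>\<^bsub>?V\<^esub> = cellfun ?J"
    by (simp add: quotient_column_module)
  have "field_span ?V (?g ` e ` C) = ?g ` cellfun ?I"
    unfolding field_span_def
  proof (rule hull_unique)
    show "?g ` e ` C \<subseteq> ?g ` cellfun ?I"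
      using Id by (intro image_mono) (auto simp: e_cellfun)
    have "submodule (?g ` cellfun ?I) T ?V"
    proof (rule left_module.submoduleI[OF V])
      show "?g ` cellfun ?I \<subseteq> carrier ?V"
        using cellfun_mono[OF IW] by (auto simp: quotient_column_module)
      show "\<zero>\<^bsub>?V\<^esub> \<in> ?g ` cellfun ?I"
        unfolding zero using coset_zero[OF subspace_cellfun zero_cellfun] zero_cellfun by blast
      show "u \<oplus>\<^bsub>?V\<^esub> w \<in> ?g ` cellfun ?I" if "u \<in> ?g ` cellfun ?I" "w \<in> ?g ` cellfun ?I" for u w
        using that cellfun_add by (auto simp: add)
      show "a \<odot>\<^bsub>?V\<^esub> u \<in> ?g ` cellfun ?I" if "a \<in> carrier T" "u \<in> ?g ` cellfun ?I" for a u
        using that T_preserves_cellfun[OF that(1) I] by (auto simp: smult)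
    qed
    then show "submodule (?g ` cellfun ?I) (matrix_ring (range mat)) ?V"
      using mat_in_T by (auto simp: submodule_def submodule_axioms_def matrix_ring_def)
  next
    fix H assume gen: "?g ` e ` C \<subseteq> H" and H: "submodule H (matrix_ring (range mat)) ?V"
    have g0: "?g v \<in> H" if "v \<in> cellfun ?J" for v
      using submoduleD(2)[OF H] coset_zero[OF subspace_cellfun that] zero by simp
    have "?g v \<in> H" if "v \<in> vec.span (e ` ?I)" for v
      using that
    proof (rule vec.span_induct)
      show "vec.subspace {v. ?g v \<in> H}"
      proof (rule vec.subspaceI)
        show "0 \<in> {v. ?g v \<in> H}" using g0[OF zero_cellfun] by simp
        show "v + w \<in> {v. ?g v \<in> H}" if "v \<in> {v. ?g v \<in> H}" "w \<in> {v. ?g v \<in> H}" for v w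
          using submoduleD(3)[OF H, of "?g v" "?g w"] that by (simp add: add)
        show "c *s v \<in> {v. ?g v \<in> H}" if "v \<in> {v. ?g v \<in> H}" for c v
          using submoduleD(4)[OF H, of "mat c" "?g v"] that by (simp add: scale matrix_ring_def)
      qed
      show "?g w \<in> H" if "w \<in> e ` ?I" for w
        using that gen g0 Id by (auto simp: e_cellfun)
    qed
    then show "?g ` cellfun ?I \<subseteq> H"
      using span_e[OF Id] by auto
  qed
  moreover have "set_add (column_module (cellfun (divisible q))) = set_add (column_module (cellfun ?I))"
    by (simp add: fun_eq_iff set_add_def')
  ultimately show ?thesis
    by (simp add: Irr_def W_space_eq Let_def gens) (simp add: quotient_column_module)
qed

lemma Irr_isomorphic_layer:
  assumes C: "C \<in> Q_classes p d R q"
  shows "module_isomorphic T (layer C) (Irr p d R x q C)"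
proof -
  have "C \<union> divisible (Suc q) - divisible (Suc q) = C"
    using Q_class(2)[OF C] by (auto simp: S_set_eq)
  then show ?thesis
    using quotient_isomorphic_layer[OF forward_closed_Q_class[OF C] forward_closed_divisible, of "Suc q"]
    by (simp add: Irr_eq[OF C])
qed

lemma left_module_layer_component:
  assumes "C \<in> components"
  shows "left_module T (layer C)"
proof -
  obtain q where C: "C \<in> Q_classes p d R q"
    using assms components_eq_Q_classes by auto
  have "C \<union> divisible (Suc q) - divisible (Suc q) = C"
    using Q_class(2)[OF C] by (auto simp: S_set_eq)
  then show ?thesis
    using left_module_layer[OF forward_closed_Q_class[OF C] forward_closed_divisible, of "Suc q"] by simp
qed

lemma layer_isomorphic_imp_eq:
  assumes C: "C \<in> components" and D: "D \<in> components"
    and iso: "module_isomorphic T (layer C) (layer D)"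
  shows "C = D"
proof
  note LC = left_module_layer_component[OF C] and LD = left_module_layer_component[OF D]
  show "C \<subseteq> D"
    by (rule layer_isomorphic_imp_subset[OF LC LD component_subset[OF C] iso])
  show "D \<subseteq> C"
    by (rule layer_isomorphic_imp_subset[OF LD LC component_subset[OF D] module_isomorphic_sym[OF LC iso]])
qed

section \<open>Matching composition factors with components\<close>

text \<open>The component that labels an isomorphism class of irreducible modules.\<close>

definition factor_type :: "('f ^ 'x ^ 'x, ('f ^ 'x) set) module \<Rightarrow> nat set \<Rightarrow> bool" where
  "factor_type M C \<longleftrightarrow> C \<in> components \<and> module_isomorphic T (layer C) M"

lemma factor_type_iso:
  assumes "factor_type M C" and "factor_type N D"
  shows "module_isomorphic T M N \<longleftrightarrow> C = D"
proof -
  have C: "C \<in> components" "module_isomorphic T (layer C) M"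
    and D: "D \<in> components" "module_isomorphic T (layer D) N"
    using assms by (auto simp: factor_type_def)
  note MC = module_isomorphic_sym[OF left_module_layer_component[OF C(1)] C(2)]
    and ND = module_isomorphic_sym[OF left_module_layer_component[OF D(1)] D(2)]
  show ?thesis
  proof
    assume "module_isomorphic T M N"
    from module_isomorphic_trans[OF module_isomorphic_trans[OF C(2) this] ND]
    show "C = D" by (rule layer_isomorphic_imp_eq[OF C(1) D(1)])
  next
    assume "C = D"
    then show "module_isomorphic T M N" using module_isomorphic_trans[OF MC] D(2) by simp
  qed
qed

lemma factor_type_unique: "factor_type M C \<Longrightarrow> factor_type M D \<Longrightarrow> C = D"
  using factor_type_iso module_isomorphic_sym module_isomorphic_trans left_module_layer_component
    layer_isomorphic_imp_eq unfolding factor_type_def by meson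

lemma factor_type_Irr: "C \<in> Q_classes p d R q \<Longrightarrow> factor_type (Irr p d R x q C) C"
  using Q_class(1) Irr_isomorphic_layer by (simp add: factor_type_def)

lemma Irr_modules_factor_type:
  "N \<in> Irr_modules p d R x \<Longrightarrow> \<exists>C. factor_type N C"
  using factor_type_Irr by (auto simp: Irr_modules_def)

lemma Irr_modules_unique:
  assumes "C \<in> components" shows "\<exists>!N. N \<in> Irr_modules p d R x \<and> factor_type N C"
proof -
  obtain q where q: "q \<in> Q_index p d R" "C \<in> Q_classes p d R q"
    using assms components_eq_Q_classes by auto
  show ?thesis
  proof (rule ex1I)
    show "Irr p d R x q C \<in> Irr_modules p d R x \<and> factor_type (Irr p d R x q C) C"
      using q factor_type_Irr[OF q(2)] by (auto simp: Irr_modules_def)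
    fix N assume N: "N \<in> Irr_modules p d R x \<and> factor_type N C"
    then obtain q' C' where N': "C' \<in> Q_classes p d R q'" "N = Irr p d R x q' C'"
      by (auto simp: Irr_modules_def)
    then have "C' = C" using factor_type_unique[OF factor_type_Irr[OF N'(1)]] N by auto
    then show "N = Irr p d R x q C" using N' Q_classes_disjoint q(2) by auto
  qed
qed

lemma composition_series_factor_types:
  assumes "composition_series T (primary_module d R x) H n"
  shows "n = card components"
    and "k < n \<Longrightarrow> \<exists>C. factor_type (series_factor (primary_module d R x) H k) C"
    and "C \<in> components \<Longrightarrow> \<exists>k<n. factor_type (series_factor (primary_module d R x) H k) C"
proof -
  obtain c where c: "bij_betw c {..<n} components"
    and iso: "\<And>k. k < n \<Longrightarrow> module_isomorphic T (layer (c k)) (series_factor (primary_module d R x) H k)"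
    using composition_series_factors[OF assms] by blast
  show "n = card components" using bij_betw_same_card[OF c] by simp
  have type: "factor_type (series_factor (primary_module d R x) H k) (c k)" if "k < n" for k
    using iso[OF that] bij_betwE[OF c] that by (simp add: factor_type_def)
  then show "k < n \<Longrightarrow> \<exists>C. factor_type (series_factor (primary_module d R x) H k) C" by blast
  assume "C \<in> components"
  then have "C \<in> c ` {..<n}" using bij_betw_imp_surj_on[OF c] by simp
  then obtain k where "k < n" "c k = C" by blast
  then show "\<exists>k<n. factor_type (series_factor (primary_module d R x) H k) C" using type by blast
qed

lemma composition_factors_primary:
  shows "M \<in> composition_factors T (primary_module d R x) \<Longrightarrow> \<exists>C. factor_type M C"
    and "C \<in> components \<Longrightarrow> \<exists>M\<in>composition_factors T (primary_module d R x). factor_type M C"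
proof -
  assume "M \<in> composition_factors T (primary_module d R x)"
  then show "\<exists>C. factor_type M C"
    using composition_series_factor_types(2) by (auto simp: composition_factors_def)
next
  assume C: "C \<in> components"
  obtain H n where cs: "composition_series T (primary_module d R x) H n"
    using composition_series_exists by blast
  obtain k where "k < n" "factor_type (series_factor (primary_module d R x) H k) C"
    using composition_series_factor_types(3)[OF cs C] by blast
  then show "\<exists>M\<in>composition_factors T (primary_module d R x). factor_type M C"
    using cs unfolding composition_factors_def by blast
qed

lemma composition_length_primary: "composition_length T (primary_module d R x) = card components"
  unfolding composition_length_def
proof (rule the_equality)
  show "\<exists>H. composition_series T (primary_module d R x) H (card components)"
    using composition_series_exists composition_series_factor_types(1) by metis
qed (use composition_series_factor_types(1) in blast)

lemma card_isomorphism_classes_primary: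
  "card (isomorphism_classes T (composition_factors T (primary_module d R x))) = card components"
proof -
  let ?F = "composition_factors T (primary_module d R x)"
  define type where "type M = (THE C. factor_type M C)" for M
  have type_eq: "type M = C" if "factor_type M C" for M C
    unfolding type_def using that factor_type_unique by (intro the_equality) blast+
  have type: "factor_type M (type M)" if "M \<in> ?F" for M
    using composition_factors_primary(1)[OF that] type_eq by auto
  have "{(M, N). M \<in> ?F \<and> N \<in> ?F \<and> module_isomorphic T M N} = {(M, N). M \<in> ?F \<and> N \<in> ?F \<and> type M = type N}"
    using factor_type_iso[OF type type] by blast
  then have "card (isomorphism_classes T ?F) = card (type ` ?F)"
    unfolding isomorphism_classes_def using card_quotient_kernel[of ?F type] by simp
  also have "type ` ?F = components"
  proof
    show "type ` ?F \<subseteq> components" using type by (auto simp: factor_type_def)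
    show "components \<subseteq> type ` ?F"
      using composition_factors_primary(2) type_eq by (metis image_eqI subsetI)
  qed
  finally show ?thesis .
qed

lemma equal_up_to_iso_series:
  assumes "composition_series T (primary_module d R x) H n"
  shows "equal_up_to_iso T {series_factor (primary_module d R x) H k | k. k < n} (Irr_modules p d R x)"
  unfolding equal_up_to_iso_def
proof (intro conjI ballI)
  fix M assume "M \<in> {series_factor (primary_module d R x) H k | k. k < n}"
  then obtain C where C: "factor_type M C"
    using composition_series_factor_types(2)[OF assms] by blast
  then obtain N where N: "N \<in> Irr_modules p d R x" "factor_type N C"
    using Irr_modules_unique unfolding factor_type_def by blast
  then have "module_isomorphic T M N"
    using factor_type_iso[OF C N(2)] by simp
  then show "\<exists>N\<in>Irr_modules p d R x. module_isomorphic T M N" using N(1) by blast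
next
  fix N :: "('f ^ 'x ^ 'x, ('f ^ 'x) set) module" assume "N \<in> Irr_modules p d R x"
  then obtain C where C: "factor_type N C" using Irr_modules_factor_type by blast
  then obtain k where k: "k < n" "factor_type (series_factor (primary_module d R x) H k) C"
    using composition_series_factor_types(3)[OF assms] unfolding factor_type_def by blast
  then have "module_isomorphic T (series_factor (primary_module d R x) H k) N"
    using factor_type_iso[OF k(2) C] by simp
  then show "\<exists>M\<in>{series_factor (primary_module d R x) H k | k. k < n}. module_isomorphic T M N"
    using k(1) by blast
qed

lemma complete_representatives_primary:
  "complete_representatives T (composition_factors T (primary_module d R x)) (Irr_modules p d R x)"
  unfolding complete_representatives_def
proof (intro conjI ballI)
  fix N :: "('f ^ 'x ^ 'x, ('f ^ 'x) set) module" assume "N \<in> Irr_modules p d R x"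
  then obtain C where C: "factor_type N C" using Irr_modules_factor_type by blast
  then obtain M where M: "M \<in> composition_factors T (primary_module d R x)" "factor_type M C"
    using composition_factors_primary(2) unfolding factor_type_def by blast
  then show "\<exists>M\<in>composition_factors T (primary_module d R x). module_isomorphic T M N"
    using factor_type_iso[OF M(2) C] by blast
next
  fix M assume "M \<in> composition_factors T (primary_module d R x)"
  then obtain C where C: "factor_type M C" using composition_factors_primary(1) by blast
  then have "C \<in> components" by (simp add: factor_type_def)
  moreover have "module_isomorphic T M N \<longleftrightarrow> factor_type N C" if N: "N \<in> Irr_modules p d R x" for N
  proof -
    obtain D where D: "factor_type N D" using Irr_modules_factor_type[OF N] by blast
    show ?thesis
      using factor_type_iso[OF C D] factor_type_unique[OF D] D by blast
  qed
  ultimately show "\<exists>!N. N \<in> Irr_modules p d R x \<and> module_isomorphic T M N"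
    using Irr_modules_unique by (metis (no_types, lifting))
qed

end

theorem theorem3p15:
  fixes d p :: nat
    and R :: "nat \<Rightarrow> ('x::finite \<times> 'x) set"
    and x :: 'x
    and T :: "('f::field ^ 'x ^ 'x) ring"
    and W0 :: "('f ^ 'x ^ 'x, 'f ^ 'x) module"
  assumes "association_scheme d R"
    and "p = CHAR('f)" and "p > 0"
    and "T = terwilliger_algebra d R x"
    and "W0 = primary_module d R x"
  shows "(\<exists>H l. composition_series T W0 H l \<and>
            equal_up_to_iso T {series_factor W0 H k | k. k < l} (Irr_modules p d R x))
       \<and> complete_representatives T (composition_factors T W0) (Irr_modules p d R x)
       \<and> (\<Sum>q\<in>Q_index p d R. card (Q_classes p d R q)) = composition_length T W0
       \<and> (\<Sum>q\<in>Q_index p d R. card (Q_classes p d R q))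
           = card (isomorphism_classes T (composition_factors T W0))"
proof -
  have "prime p"
    unfolding assms(2) by (rule prime_CHAR_semidom) (use assms(2,3) in simp)
  then interpret terwilliger d R x p T
    using assms by unfold_locales
  show ?thesis
    unfolding assms(5) card_components composition_length_primary card_isomorphism_classes_primary
    using composition_series_exists equal_up_to_iso_series complete_representatives_primary by blast
qed

end
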